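(* Let $K$ be a field and, for $n\ge 1$ and $p=p(n)\in[0,1]$, let $I(n,p)\subset K[x_1,\ldots,x_n]$ be the edge ideal of the Erd\H{o}s--R\'enyi random graph $G(n,p)$. Then $$\lim_{n\to\infty}\Pr\big(I(n,p)\text{ has a linear resolution}\big)=\lim_{n\to\infty}\Pr\big(I(n,p)\text{ has a linear presentation}\big)=\begin{cases}1 & \text{if } (n(1-p))^4p^2\to 0,\\ 0 & \text{if } (n(1-p))^4p^2\to\infty.\end{cases}$$ Further, if $p=p(n)$ is a sequence such that $\lim_{n\to\infty} n(1-p)\in\{0,\infty\}$, then $$\lim_{n\to\infty}\Pr\big(I(n,p)\text{ does not have a linear resolution but has a linear presentation}\big)=0.$$
   Context: The Erd\H{o}s--R\'enyi random graph $G(n,p)$ has vertex set $[n]=\{1,\ldots,n\}$, and each pair $\{i,j\}$, $i\ne j$, is an edge independently with probability $p$. For a simple graph $G$ on $[n]$, its edge ideal is $I(G)=(x_ix_j : \{i,j\}\in E(G))\subset K[x_1,\ldots,x_n]$, and $I(n,p):=I(G(n,p))$. A homogeneous ideal has a linear presentation if the matrix of the first map of its minimal graded free resolution (the presentation matrix) has only linear or zero entries; it has a linear resolution if all maps in its minimal graded free resolution have linear entries (for an edge ideal, equivalently its Castelnuovo--Mumford regularity equals $2$). *)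

theory Defs
  imports "HOL-Probability.Probability" "HOL-Library.Poly_Mapping" "Jordan_Normal_Form.Matrix"
begin

no_notation Finite_Cartesian_Product.vec_nth (infixl "$" 90)

section \<open>The polynomial ring in finitely many variables\<close>

text \<open>A monomial is its exponent vector \<open>nat \<Rightarrow>\<^sub>0 nat\<close>, and the product on \<^type>\<open>poly_mapping\<close> is
  the convolution product, so \<open>'k mpoly\<close> is the polynomial ring over \<open>'k\<close> in countably many
  variables.  The ring $S = K[x_1,\ldots,x_n]$, with the number of variables a parameter, is the subring
  \<open>poly_ring n\<close>.\<close>

type_synonym 'k mpoly = "(nat \<Rightarrow>\<^sub>0 nat) \<Rightarrow>\<^sub>0 'k"

definition Var :: "nat \<Rightarrow> 'k::comm_ring_1 mpoly" where
  "Var i = Poly_Mapping.single (Poly_Mapping.single i 1) 1"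

definition poly_ring :: "nat \<Rightarrow> 'k::comm_ring_1 mpoly set" where
  "poly_ring n = {f. \<forall>m \<in> Poly_Mapping.keys f. Poly_Mapping.keys m \<subseteq> {1..n}}"

definition total_degree :: "(nat \<Rightarrow>\<^sub>0 nat) \<Rightarrow> nat" where
  "total_degree m = (\<Sum>i \<in> Poly_Mapping.keys m. Poly_Mapping.lookup m i)"

text \<open>The zero polynomial is homogeneous of every degree, and it is the only one that is homogeneous
  of a negative degree.\<close>

definition homogeneous :: "int \<Rightarrow> 'k::comm_ring_1 mpoly \<Rightarrow> bool" where
  "homogeneous d f \<longleftrightarrow> (\<forall>m \<in> Poly_Mapping.keys f. int (total_degree m) = d)"

definition ideal_generated :: "nat \<Rightarrow> 'k::comm_ring_1 mpoly set \<Rightarrow> 'k mpoly set" where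
  "ideal_generated n B =
     {\<Sum>b\<in>A. c b * b | A c. finite A \<and> A \<subseteq> B \<and> (\<forall>b\<in>A. c b \<in> poly_ring n)}"

definition irrelevant_ideal :: "nat \<Rightarrow> 'k::comm_ring_1 mpoly set" where
  "irrelevant_ideal n = ideal_generated n (Var ` {1..n})"

section \<open>Minimal graded free resolutions\<close>

definition free_module :: "nat \<Rightarrow> nat \<Rightarrow> 'k::comm_ring_1 mpoly vec set" where
  "free_module n r = {v \<in> carrier_vec r. \<forall>j<r. v $ j \<in> poly_ring n}"

text \<open>A graded free resolution
  $\cdots \to F_2 \to F_1 \to F_0 \to I \to 0$ of an ideal \<open>I\<close> of $S$
  by free modules of finite rank.  The matrix \<open>\<phi> 0\<close> has one row and represents the
  augmentation $F_0 \to I \subseteq S$ (its entries are the chosen generators of \<open>I\<close>), and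
  \<open>\<phi> (Suc i)\<close> represents the map $F_{i+1} \to F_i$, acting on column vectors.  Thus $F_i$ has
  rank \<open>dim_col (\<phi> i)\<close>, which may be \<open>0\<close>, and \<open>d i j\<close> is the degree of its \<open>j\<close>-th basis element,
  i.e. $F_i = \bigoplus_j S(-d_{i,j})$; the homogeneity conditions say that all maps have
  degree \<open>0\<close>.\<close>

definition graded_free_resolution ::
  "nat \<Rightarrow> 'k::comm_ring_1 mpoly set \<Rightarrow> (nat \<Rightarrow> 'k mpoly mat) \<Rightarrow> (nat \<Rightarrow> nat \<Rightarrow> int) \<Rightarrow> bool" where
  "graded_free_resolution n I \<phi> d \<longleftrightarrow>
     dim_row (\<phi> 0) = 1 \<and>
     (\<forall>i. dim_row (\<phi> (Suc i)) = dim_col (\<phi> i)) \<and>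
     (\<forall>i. elements_mat (\<phi> i) \<subseteq> poly_ring n) \<and>
     (\<forall>c < dim_col (\<phi> 0). homogeneous (d 0 c) (\<phi> 0 $$ (0, c))) \<and>
     (\<forall>i. \<forall>r < dim_col (\<phi> i). \<forall>c < dim_col (\<phi> (Suc i)).
        homogeneous (d (Suc i) c - d i r) (\<phi> (Suc i) $$ (r, c))) \<and>
     (\<lambda>v. (\<phi> 0 *\<^sub>v v) $ 0) ` free_module n (dim_col (\<phi> 0)) = I \<and>
     (\<forall>i. {v \<in> free_module n (dim_col (\<phi> i)). \<phi> i *\<^sub>v v = 0\<^sub>v (dim_row (\<phi> i))} =
          (\<lambda>v. \<phi> (Suc i) *\<^sub>v v) ` free_module n (dim_col (\<phi> (Suc i))))"

definition minimal_graded_free_resolution ::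
  "nat \<Rightarrow> 'k::comm_ring_1 mpoly set \<Rightarrow> (nat \<Rightarrow> 'k mpoly mat) \<Rightarrow> (nat \<Rightarrow> nat \<Rightarrow> int) \<Rightarrow> bool" where
  "minimal_graded_free_resolution n I \<phi> d \<longleftrightarrow>
     graded_free_resolution n I \<phi> d \<and>
     (\<forall>i. elements_mat (\<phi> (Suc i)) \<subseteq> irrelevant_ideal n)"

text \<open>The minimal graded free resolution is unique up to isomorphism of graded complexes, and for an
  ideal generated in a single degree (such as an edge ideal) the following conditions do not depend
  on the choice of homogeneous bases.  ``Linear'' means homogeneous of degree \<open>1\<close>, so zero entries
  are allowed; the augmentation \<open>\<phi> 0\<close> is not one of the maps of the resolution.  The zero ideal has
  the zero resolution and hence satisfies both conditions.\<close>

definition has_linear_presentation :: "nat \<Rightarrow> 'k::comm_ring_1 mpoly set \<Rightarrow> bool" where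
  "has_linear_presentation n I \<longleftrightarrow>
     (\<exists>\<phi> d. minimal_graded_free_resolution n I \<phi> d \<and>
        (\<forall>f \<in> elements_mat (\<phi> 1). homogeneous 1 f))"

definition has_linear_resolution :: "nat \<Rightarrow> 'k::comm_ring_1 mpoly set \<Rightarrow> bool" where
  "has_linear_resolution n I \<longleftrightarrow>
     (\<exists>\<phi> d. minimal_graded_free_resolution n I \<phi> d \<and>
        (\<forall>i. \<forall>f \<in> elements_mat (\<phi> (Suc i)). homogeneous 1 f))"

section \<open>Edge ideals and the random graph\<close>

text \<open>A simple graph on $[n]$ is represented by its edge set, a subset of \<open>vertex_pairs n\<close>.\<close>

definition vertex_pairs :: "nat \<Rightarrow> nat set set" where
  "vertex_pairs n = {{i, j} | i j. i \<in> {1..n} \<and> j \<in> {1..n} \<and> i \<noteq> j}"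

text \<open>The first argument only fixes the coefficient field.\<close>

definition edge_ideal :: "'k::field itself \<Rightarrow> nat \<Rightarrow> nat set set \<Rightarrow> 'k mpoly set" where
  "edge_ideal K n G = ideal_generated n {Var i * Var j | i j. {i, j} \<in> G}"

text \<open>The Erd\H{o}s--R\'enyi model: one independent Bernoulli variable per pair of vertices.\<close>

definition random_graph :: "nat \<Rightarrow> real \<Rightarrow> nat set set pmf" where
  "random_graph n p =
     map_pmf (\<lambda>f. {e \<in> vertex_pairs n. f e})
       (Pi_pmf (vertex_pairs n) False (\<lambda>_. bernoulli_pmf p))"

end

theory Submission
  imports Defs "HOL-Real_Asymp.Real_Asymp"
begin

text \<open>Write $q = 1 - p$ and $z = (nq)^2 p$, so that $(nq)^4 p^2 = z^2$.

  If \<open>J \<subseteq> Q\<close> have linear resolutions, the generators of \<open>J\<close> being one degree higher than those of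
  \<open>Q\<close>, and a variable $x$ is regular modulo \<open>J\<close>, then $0 \to xJ \to J \oplus xQ \to J + xQ \to 0$
  is exact, and the mapping cone of a lift of $xJ \to J \oplus xQ$ is a linear resolution of $J + xQ$.
  Hence ideals generated by variables, and by elimination of vertices edge ideals of graphs all of
  whose vertex sets \<open>W\<close> contain a vertex $v$ such that each edge in \<open>W - {v}\<close> has an endpoint adjacent to
  $v$, have linear resolutions.  An edgeless graph has this property, and so does a graph in
  whose complement each vertex set contains a vertex of degree at most one.  The first case has
  failure probability at most $n^2 p$, the second one at most a multiple of $nq$, and one of these
  is small when $z$ is.

  Conversely, two edges $ab$ and $cd$ without connecting edges obstruct a linear presentation:
  the coefficient of $x_c x_d$ in the component at $x_a x_b$ of the Koszul syzygy of $x_a x_b$ and $x_c x_d$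
  cannot come from linear syzygies.  By the second moment method such a pair exists with high
  probability if $z \to \infty$.  If $nq \to \infty$ and $z$ is not large, then $p$ is so small that
  with high probability no two edges meet; in the absence of such a pair there is at most one edge.\<close>

section \<open>Polynomials and monomial ideals\<close>

text \<open>Both linearity notions are existential over explicit matrices, so a linear resolution
  has to be written down in full, while the obstruction must defeat every choice of generators and
  syzygies. For the construction, bases are finite sets of labels, so that direct sums are disjoint
  unions of labels; matrices appear only at the end. Degrees explain why a cone stays linear. Let F
  resolve J, generated in degree d + 1, and K resolve Q, generated in degree d. In step i, both F_i
  and the copy of K_i for xQ have basis degree d + 1 + i, and F_{i-1}, as part of a resolution of
  xJ, has degree (d + 2) + (i - 1), the same number. Linear entries in turn make minimality
  automatic. For a vertex v of W, the edge ideal of W is that of W - {v} plus x_v times the ideal Q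
  generated by the neighbours of v; the adjacency condition says exactly that the former ideal lies
  in Q. The condition is chordality of the complement, phrased as a simplicial vertex in every
  induced subgraph. Asking for it in every W, rather than for one ordering, gives each failure a
  certificate that a first moment bound can count: a set W with at least |W| missing pairs.\<close>

abbreviation mdvd :: "(nat \<Rightarrow>\<^sub>0 nat) \<Rightarrow> (nat \<Rightarrow>\<^sub>0 nat) \<Rightarrow> bool" where
  "mdvd g m \<equiv> \<exists>k. m = g + k"

lemma sum_single_lookup: "(\<Sum>m\<in>Poly_Mapping.keys f. Poly_Mapping.single m (Poly_Mapping.lookup f m)) = f"
proof (rule poly_mapping_eqI)
  fix k
  have "Poly_Mapping.lookup (\<Sum>m\<in>Poly_Mapping.keys f. Poly_Mapping.single m (Poly_Mapping.lookup f m)) k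
      = (\<Sum>m\<in>Poly_Mapping.keys f. if m = k then Poly_Mapping.lookup f m else 0)"
    by (simp add: lookup_sum lookup_single when_def)
  also have "\<dots> = Poly_Mapping.lookup f k"
    by (simp add: sum.delta' in_keys_iff)
  finally show "Poly_Mapping.lookup (\<Sum>m\<in>Poly_Mapping.keys f. Poly_Mapping.single m (Poly_Mapping.lookup f m)) k = Poly_Mapping.lookup f k" .
qed

lemma lookup_times_keys:
  fixes f g :: "'a::comm_monoid_add \<Rightarrow>\<^sub>0 'k::comm_ring_1"
  shows "Poly_Mapping.lookup (f * g) k =
    (\<Sum>a\<in>Poly_Mapping.keys f. \<Sum>b\<in>Poly_Mapping.keys g. if a + b = k then Poly_Mapping.lookup f a * Poly_Mapping.lookup g b else 0)"
proof -
  have "f * g = (\<Sum>m\<in>Poly_Mapping.keys f. Poly_Mapping.single m (Poly_Mapping.lookup f m)) *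
     (\<Sum>m\<in>Poly_Mapping.keys g. Poly_Mapping.single m (Poly_Mapping.lookup g m))"
    by (simp add: sum_single_lookup)
  also have "\<dots> = (\<Sum>a\<in>Poly_Mapping.keys f. \<Sum>b\<in>Poly_Mapping.keys g. Poly_Mapping.single (a + b) (Poly_Mapping.lookup f a * Poly_Mapping.lookup g b))"
    by (simp add: sum_product mult_single)
  finally show ?thesis
    by (simp add: lookup_sum lookup_single when_def)
qed

lemma lookup_single_times:
  fixes f :: "(nat \<Rightarrow>\<^sub>0 nat) \<Rightarrow>\<^sub>0 'k::comm_ring_1"
  shows "Poly_Mapping.lookup (Poly_Mapping.single m c * f) (m + k) = c * Poly_Mapping.lookup f k"
proof (cases "c = 0")
  case False
  then show ?thesis
    by (simp add: lookup_times_keys sum.delta' in_keys_iff cong: if_cong)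
qed simp

lemma lookup_single_times_not_mdvd:
  fixes f :: "(nat \<Rightarrow>\<^sub>0 nat) \<Rightarrow>\<^sub>0 'k::comm_ring_1"
  assumes "\<not> mdvd m k"
  shows "Poly_Mapping.lookup (Poly_Mapping.single m c * f) k = 0"
  using assms by (auto simp: lookup_times_keys intro!: sum.neutral)

lemma total_degree_superset:
  assumes "finite A" "Poly_Mapping.keys m \<subseteq> A"
  shows "total_degree m = (\<Sum>i\<in>A. Poly_Mapping.lookup m i)"
  unfolding total_degree_def using assms
  by (intro sum.mono_neutral_left) (auto simp: in_keys_iff)

lemma total_degree_add: "total_degree (a + b) = total_degree a + total_degree b"
proof -
  let ?A = "Poly_Mapping.keys a \<union> Poly_Mapping.keys b"
  have "total_degree (a + b) = (\<Sum>i\<in>?A. Poly_Mapping.lookup (a + b) i)"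
    by (rule total_degree_superset) (use keys_add[of a b] in auto)
  also have "\<dots> = (\<Sum>i\<in>?A. Poly_Mapping.lookup a i) + (\<Sum>i\<in>?A. Poly_Mapping.lookup b i)"
    by (simp add: lookup_add sum.distrib)
  also have "\<dots> = total_degree a + total_degree b"
    by (subst (1 2) total_degree_superset[of ?A]) auto
  finally show ?thesis .
qed

lemma total_degree_single [simp]: "total_degree (Poly_Mapping.single i c) = c"
  by (cases "c = 0") (auto simp: total_degree_def)

lemma total_degree_1E:
  assumes "total_degree m = 1"
  obtains i where "m = Poly_Mapping.single i 1"
proof -
  have "\<exists>i. i \<in> Poly_Mapping.keys m"
    using assms by (metis One_nat_def sum.empty total_degree_def equals0I zero_neq_one)
  then obtain i where i: "i \<in> Poly_Mapping.keys m" by blast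
  have eq: "(\<Sum>i\<in>Poly_Mapping.keys m. Poly_Mapping.lookup m i) = Poly_Mapping.lookup m i + (\<Sum>j\<in>Poly_Mapping.keys m - {i}. Poly_Mapping.lookup m j)"
    using i by (simp add: sum.remove)
  have "Poly_Mapping.lookup m i > 0" using i by (simp add: in_keys_iff)
  moreover have "Poly_Mapping.lookup m i + (\<Sum>j\<in>Poly_Mapping.keys m - {i}. Poly_Mapping.lookup m j) = 1"
    using assms eq by (simp add: total_degree_def)
  ultimately have 1: "Poly_Mapping.lookup m i = 1" "(\<Sum>j\<in>Poly_Mapping.keys m - {i}. Poly_Mapping.lookup m j) = 0"
    by linarith+
  then have "\<forall>j\<in>Poly_Mapping.keys m - {i}. Poly_Mapping.lookup m j = 0" by simp
  then have "m = Poly_Mapping.single i 1"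
    using 1 by (intro poly_mapping_eqI) (auto simp: lookup_single when_def in_keys_iff)
  then show ?thesis by (rule that)
qed

lemma poly_ring_0 [simp]: "0 \<in> poly_ring n"
  and poly_ring_1 [simp]: "1 \<in> poly_ring n"
  and poly_ring_Var: "i \<in> {1..n} \<Longrightarrow> Var i \<in> poly_ring n"
  by (auto simp: poly_ring_def Var_def)

lemma poly_ring_add: "f \<in> poly_ring n \<Longrightarrow> g \<in> poly_ring n \<Longrightarrow> f + g \<in> poly_ring n"
  using keys_add[of f g] by (fastforce simp: poly_ring_def)

lemma poly_ring_uminus: "f \<in> poly_ring n \<Longrightarrow> - f \<in> poly_ring n"
  by (auto simp: poly_ring_def)

lemma poly_ring_diff: "f \<in> poly_ring n \<Longrightarrow> g \<in> poly_ring n \<Longrightarrow> f - g \<in> poly_ring n"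
  using poly_ring_add[of f n "- g"] poly_ring_uminus[of g n] by simp

lemma poly_ring_mult:
  assumes "f \<in> poly_ring n" "g \<in> poly_ring n"
  shows "f * g \<in> poly_ring n"
proof -
  have "Poly_Mapping.keys m \<subseteq> {1..n}" if m: "m \<in> Poly_Mapping.keys (f * g)" for m
  proof -
    from m keys_mult[of f g] obtain a b where ab: "m = a + b" "a \<in> Poly_Mapping.keys f" "b \<in> Poly_Mapping.keys g"
      by blast
    then show ?thesis using keys_add[of a b] assms by (fastforce simp: poly_ring_def)
  qed
  then show ?thesis by (simp add: poly_ring_def)
qed

lemma poly_ring_sum: "(\<And>i. i \<in> A \<Longrightarrow> f i \<in> poly_ring n) \<Longrightarrow> sum f A \<in> poly_ring n"
  by (induction A rule: infinite_finite_induct) (auto intro: poly_ring_add)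

lemma homogeneous_0 [simp]: "homogeneous d 0"
  by (simp add: homogeneous_def)

lemma homogeneous_add: "homogeneous d f \<Longrightarrow> homogeneous d g \<Longrightarrow> homogeneous d (f + g)"
  using keys_add[of f g] by (auto simp: homogeneous_def)

lemma homogeneous_uminus: "homogeneous d f \<Longrightarrow> homogeneous d (- f)"
  by (auto simp: homogeneous_def)

lemma homogeneous_sum: "(\<And>i. i \<in> A \<Longrightarrow> homogeneous d (f i)) \<Longrightarrow> homogeneous d (sum f A)"
  by (induction A rule: infinite_finite_induct) (auto intro: homogeneous_add)

lemma homogeneous_mult:
  assumes "homogeneous d f" "homogeneous e g"
  shows "homogeneous (d + e) (f * g)"
  unfolding homogeneous_def
proof
  fix m assume "m \<in> Poly_Mapping.keys (f * g)"
  then obtain a b where "m = a + b" "a \<in> Poly_Mapping.keys f" "b \<in> Poly_Mapping.keys g"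
    using keys_mult[of f g] by blast
  then show "int (total_degree m) = d + e"
    using assms by (auto simp: homogeneous_def total_degree_add)
qed

lemma homogeneous_Var: "homogeneous 1 (Var i)"
  by (auto simp: homogeneous_def Var_def)

lemma homogeneous_one: "homogeneous 0 1"
  by (auto simp: homogeneous_def total_degree_def)

definition degree_part :: "nat \<Rightarrow> 'k::comm_ring_1 mpoly \<Rightarrow> 'k mpoly" where
  "degree_part d f =
     (\<Sum>m \<in> {m \<in> Poly_Mapping.keys f. total_degree m = d}. Poly_Mapping.single m (Poly_Mapping.lookup f m))"

lemma lookup_degree_part: "Poly_Mapping.lookup (degree_part d f) m = (if total_degree m = d then Poly_Mapping.lookup f m else 0)"
proof -
  have "Poly_Mapping.lookup (degree_part d f) m =
     (\<Sum>m'\<in>{m \<in> Poly_Mapping.keys f. total_degree m = d}. if m' = m then Poly_Mapping.lookup f m' else 0)"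
    unfolding degree_part_def by (simp add: lookup_sum lookup_single when_def)
  also have "\<dots> = (if m \<in> {m \<in> Poly_Mapping.keys f. total_degree m = d} then Poly_Mapping.lookup f m else 0)"
    by (rule sum.delta) simp
  finally show ?thesis by (simp add: in_keys_iff)
qed

lemma homogeneous_degree_part: "homogeneous (int d) (degree_part d f)"
  by (auto simp: homogeneous_def in_keys_iff lookup_degree_part split: if_splits)

lemma poly_ring_degree_part: "f \<in> poly_ring n \<Longrightarrow> degree_part d f \<in> poly_ring n"
  unfolding poly_ring_def mem_Collect_eq by (metis in_keys_iff lookup_degree_part)

lemma degree_part_homogeneous: "homogeneous (int d) f \<Longrightarrow> degree_part d f = f"
  by (rule poly_mapping_eqI) (auto simp: lookup_degree_part homogeneous_def in_keys_iff)

lemma degree_part_sum: "degree_part d (sum f A) = (\<Sum>i\<in>A. degree_part d (f i))"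
  by (rule poly_mapping_eqI) (simp add: lookup_degree_part lookup_sum)

text \<open>This makes lifts homogeneous: in an equation with homogeneous coefficients, the unknowns
  may be replaced by their components of the right degree.\<close>

lemma degree_part_mult:
  assumes "homogeneous (int e) g"
  shows "degree_part (e + d) (g * f) = g * degree_part d f"
proof (rule poly_mapping_eqI)
  fix m
  have eq: "Poly_Mapping.lookup g a * Poly_Mapping.lookup (degree_part d f) b = (if total_degree m = e + d then Poly_Mapping.lookup g a * Poly_Mapping.lookup f b else 0)"
    if "a + b = m" "a \<in> Poly_Mapping.keys g" for a b
    using that assms by (auto simp: homogeneous_def lookup_degree_part total_degree_add)
  have "Poly_Mapping.lookup (g * degree_part d f) m =
    (\<Sum>a\<in>Poly_Mapping.keys g. \<Sum>b\<in>Poly_Mapping.keys (degree_part d f). if a + b = m then Poly_Mapping.lookup g a * Poly_Mapping.lookup (degree_part d f) b else 0)"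
    by (rule lookup_times_keys)
  also have "\<dots> = (\<Sum>a\<in>Poly_Mapping.keys g. \<Sum>b\<in>Poly_Mapping.keys f. if a + b = m then Poly_Mapping.lookup g a * Poly_Mapping.lookup (degree_part d f) b else 0)"
    by (intro sum.cong refl sum.mono_neutral_left) (auto simp: in_keys_iff lookup_degree_part split: if_splits)
  also have "\<dots> = (\<Sum>a\<in>Poly_Mapping.keys g. \<Sum>b\<in>Poly_Mapping.keys f. if a + b = m then (if total_degree m = e + d then Poly_Mapping.lookup g a * Poly_Mapping.lookup f b else 0) else 0)"
    by (intro sum.cong refl if_cong) (use eq in auto)
  also have "\<dots> = (if total_degree m = e + d then Poly_Mapping.lookup (g * f) m else 0)"
    by (cases "total_degree m = e + d") (simp_all add: lookup_times_keys cong: if_cong)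
  finally show "Poly_Mapping.lookup (degree_part (e + d) (g * f)) m = Poly_Mapping.lookup (g * degree_part d f) m"
    by (simp add: lookup_degree_part)
qed

section \<open>Ideals generated by monomials\<close>

definition monomial_ideal :: "nat \<Rightarrow> (nat \<Rightarrow>\<^sub>0 nat) set \<Rightarrow> 'k::comm_ring_1 mpoly set" where
  "monomial_ideal n M = {f \<in> poly_ring n. \<forall>m \<in> Poly_Mapping.keys f. \<exists>g\<in>M. mdvd g m}"

lemma ideal_generated_0: "0 \<in> ideal_generated n B"
  unfolding ideal_generated_def by (rule CollectI, rule exI[of _ "{}"]) simp

lemma ideal_generated_add:
  assumes "f \<in> ideal_generated n B" "g \<in> ideal_generated n B"
  shows "f + g \<in> ideal_generated n B"
proof -
  from assms obtain A c A' c' where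
    f: "f = (\<Sum>b\<in>A. c b * b)" "finite A" "A \<subseteq> B" "\<forall>b\<in>A. c b \<in> poly_ring n" and
    g: "g = (\<Sum>b\<in>A'. c' b * b)" "finite A'" "A' \<subseteq> B" "\<forall>b\<in>A'. c' b \<in> poly_ring n"
    unfolding ideal_generated_def by blast
  define e where "e b = (if b \<in> A then c b else 0) + (if b \<in> A' then c' b else 0)" for b
  have "f = (\<Sum>b\<in>A \<union> A'. (if b \<in> A then c b else 0) * b)" 
    unfolding f(1) using f(2) g(2) by (intro sum.mono_neutral_cong_left) auto
  moreover have "g = (\<Sum>b\<in>A \<union> A'. (if b \<in> A' then c' b else 0) * b)" 
    unfolding g(1) using f(2) g(2) by (intro sum.mono_neutral_cong_left) auto
  ultimately have "f + g = (\<Sum>b\<in>A \<union> A'. e b * b)"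
    by (simp only: e_def distrib_right sum.distrib)
  moreover have "\<forall>b\<in>A \<union> A'. e b \<in> poly_ring n"
    using f(4) g(4) by (auto simp: e_def intro!: poly_ring_add)
  ultimately show ?thesis
    unfolding ideal_generated_def using f g by blast
qed

lemma ideal_generated_sum:
  "(\<And>i. i \<in> A \<Longrightarrow> f i \<in> ideal_generated n B) \<Longrightarrow> sum f A \<in> ideal_generated n B"
  by (induction A rule: infinite_finite_induct) (auto intro: ideal_generated_add ideal_generated_0)

lemma ideal_generated_multiple: "b \<in> B \<Longrightarrow> c \<in> poly_ring n \<Longrightarrow> c * b \<in> ideal_generated n B"
  unfolding ideal_generated_def
  by (rule CollectI, rule exI[of _ "{b}"], rule exI[of _ "\<lambda>_. c"]) auto

text \<open>A monomial of a sum must occur in some summand, and conversely an element is the sum of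
  its terms. Membership thus becomes divisibility of exponent vectors, tested term by term; all
  later ideal computations use this form.\<close>

lemma ideal_generated_monomials:
  assumes M: "\<And>g. g \<in> M \<Longrightarrow> Poly_Mapping.keys g \<subseteq> {1..n}"
  shows "ideal_generated n ((\<lambda>g. Poly_Mapping.single g 1) ` M) = (monomial_ideal n M :: 'k::comm_ring_1 mpoly set)"
proof
  show "ideal_generated n ((\<lambda>g. Poly_Mapping.single g 1) ` M) \<subseteq> (monomial_ideal n M :: 'k mpoly set)"
  proof
    fix f :: "'k mpoly" assume "f \<in> ideal_generated n ((\<lambda>g. Poly_Mapping.single g 1) ` M)"
    then obtain A c where f: "f = (\<Sum>b\<in>A. c b * b)" "finite A" 
       "A \<subseteq> (\<lambda>g. Poly_Mapping.single g 1) ` M" "\<forall>b\<in>A. c b \<in> poly_ring n"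
      unfolding ideal_generated_def by blast
    have "b \<in> poly_ring n" if "b \<in> A" for b
      using that f(3) M by (fastforce simp: poly_ring_def split: if_splits)
    then have "f \<in> poly_ring n"
      unfolding f(1) using f(4) by (intro poly_ring_sum poly_ring_mult) auto
    moreover have "\<exists>g\<in>M. mdvd g m" if "m \<in> Poly_Mapping.keys f" for m
    proof -
      have "Poly_Mapping.lookup f m \<noteq> 0" using that by (simp add: in_keys_iff)
      then obtain b where b: "b \<in> A" "Poly_Mapping.lookup (c b * b) m \<noteq> 0"
        unfolding f(1) lookup_sum by (meson sum.neutral)
      from b(1) f(3) obtain g where g: "g \<in> M" "b = Poly_Mapping.single g 1" by blast
      then show ?thesis using b(2) lookup_single_times_not_mdvd[where m = g and k = m and c = 1 and f = "c b"]
        by (metis mult.commute)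
    qed
    ultimately show "f \<in> monomial_ideal n M" by (simp add: monomial_ideal_def)
  qed
next
  show "(monomial_ideal n M :: 'k mpoly set) \<subseteq> ideal_generated n ((\<lambda>g. Poly_Mapping.single g 1) ` M)"
  proof
    fix f :: "'k mpoly" assume f: "f \<in> monomial_ideal n M"
    have "Poly_Mapping.single m (Poly_Mapping.lookup f m) \<in> ideal_generated n ((\<lambda>g. Poly_Mapping.single g 1) ` M)"
      if m: "m \<in> Poly_Mapping.keys f" for m
    proof -
      from f m obtain g k where g: "g \<in> M" "m = g + k" by (auto simp: monomial_ideal_def)
      have "Poly_Mapping.keys k \<subseteq> Poly_Mapping.keys m"
        by (auto simp: g in_keys_iff lookup_add)
      then have "Poly_Mapping.keys k \<subseteq> {1..n}" using f m by (auto simp: monomial_ideal_def poly_ring_def)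
      then have "Poly_Mapping.single k (Poly_Mapping.lookup f m) \<in> poly_ring n" by (auto simp: poly_ring_def)
      then have "Poly_Mapping.single k (Poly_Mapping.lookup f m) * Poly_Mapping.single g 1 \<in> ideal_generated n ((\<lambda>g. Poly_Mapping.single g 1) ` M)"
        using g by (intro ideal_generated_multiple) auto
      then show ?thesis by (simp add: mult_single g add.commute)
    qed
    then have "(\<Sum>m\<in>Poly_Mapping.keys f. Poly_Mapping.single m (Poly_Mapping.lookup f m)) \<in> ideal_generated n ((\<lambda>g. Poly_Mapping.single g 1) ` M)"
      by (rule ideal_generated_sum)
    then show "f \<in> ideal_generated n ((\<lambda>g. Poly_Mapping.single g 1) ` M)"
      by (simp add: sum_single_lookup)
  qed
qed

lemma Var_mult_Var: "Var i * Var j = Poly_Mapping.single (Poly_Mapping.single i 1 + Poly_Mapping.single j 1) 1"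
  by (simp add: Var_def mult_single)

lemma edge_ideal_monomial:
  assumes "G \<subseteq> vertex_pairs n"
  shows "edge_ideal (K :: 'k::field itself) n G =
    monomial_ideal n {Poly_Mapping.single i 1 + Poly_Mapping.single j 1 | i j. {i, j} \<in> G}"
proof -
  let ?M = "{Poly_Mapping.single i 1 + Poly_Mapping.single j 1 | i j. {i, j} \<in> G} :: (nat \<Rightarrow>\<^sub>0 nat) set"
  have *: "i \<in> {1..n} \<and> j \<in> {1..n}" if "{i, j} \<in> G" for i j
    using that assms by (fastforce simp: vertex_pairs_def doubleton_eq_iff)
  have "{Var i * Var j :: 'k mpoly | i j. {i, j} \<in> G} = (\<lambda>g. Poly_Mapping.single g 1) ` ?M"
    by (auto simp: Var_mult_Var)
  moreover have "Poly_Mapping.keys g \<subseteq> {1..n}" if "g \<in> ?M" for g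
    using that * keys_add by (fastforce split: if_splits)
  ultimately show ?thesis
    unfolding edge_ideal_def by (simp only: ideal_generated_monomials)
qed

lemma irrelevant_ideal_monomial:
  "(irrelevant_ideal n :: 'k::comm_ring_1 mpoly set) = monomial_ideal n ((\<lambda>i. Poly_Mapping.single i 1) ` {1..n})"
proof -
  have "(Var ` {1..n} :: 'k mpoly set) = (\<lambda>g. Poly_Mapping.single g 1) ` (\<lambda>i. Poly_Mapping.single i 1) ` {1..n}"
    by (auto simp: Var_def)
  then show ?thesis unfolding irrelevant_ideal_def
    by (simp only:) (rule ideal_generated_monomials, auto)
qed

text \<open>Gives minimality for free once all maps are linear.\<close>

lemma linear_in_irrelevant_ideal:
  assumes "f \<in> poly_ring n" "homogeneous 1 f"
  shows "f \<in> irrelevant_ideal n"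
proof -
  have "\<exists>g\<in>(\<lambda>i. Poly_Mapping.single i 1) ` {1..n}. mdvd g m" if m: "m \<in> Poly_Mapping.keys f" for m
  proof -
    have "total_degree m = 1" using assms(2) m by (auto simp: homogeneous_def)
    then obtain i where i: "m = Poly_Mapping.single i 1" by (rule total_degree_1E)
    then have "i \<in> {1..n}" using m assms(1) by (auto simp: poly_ring_def)
    then show ?thesis using i by (intro bexI[of _ m] exI[of _ 0]) auto
  qed
  then show ?thesis using assms(1) by (simp add: irrelevant_ideal_monomial monomial_ideal_def)
qed

section \<open>Mapping cones of linear resolutions\<close>

text \<open>A row times a column, both indexed by a set \<open>X\<close> of basis labels; values
  outside \<open>X\<close> do not matter.\<close>

definition dot :: "'i set \<Rightarrow> ('i \<Rightarrow> 'r::comm_ring_1) \<Rightarrow> ('i \<Rightarrow> 'r) \<Rightarrow> 'r" where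
  "dot X a v = (\<Sum>c\<in>X. a c * v c)"

lemma dot_cong: "(\<And>c. c \<in> X \<Longrightarrow> a c = b c) \<Longrightarrow> (\<And>c. c \<in> X \<Longrightarrow> v c = w c) \<Longrightarrow> dot X a v = dot X b w"
  unfolding dot_def by (intro sum.cong) auto

lemma dot_add_right: "dot X a (\<lambda>c. v c + w c) = dot X a v + dot X a w"
  by (simp add: dot_def algebra_simps sum.distrib)

lemma dot_diff_right: "dot X a (\<lambda>c. v c - w c) = dot X a v - dot X a w"
  by (simp add: dot_def algebra_simps sum_subtractf)

lemma dot_uminus_right: "dot X a (\<lambda>c. - v c) = - dot X a v"
  by (simp add: dot_def sum_negf)

lemma dot_uminus_left: "dot X (\<lambda>c. - a c) v = - dot X a v"
  by (simp add: dot_def sum_negf)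

lemma dot_scale_right: "dot X a (\<lambda>c. x * v c) = x * dot X a v"
  by (simp add: dot_def sum_distrib_left ac_simps)

lemma dot_scale_left: "dot X (\<lambda>c. x * a c) v = x * dot X a v"
  by (simp add: dot_def sum_distrib_left ac_simps)

lemma dot_zero_left [simp]: "dot X (\<lambda>c. 0) v = 0"
  and dot_zero_right [simp]: "dot X a (\<lambda>c. 0) = 0"
  and dot_empty [simp]: "dot {} a v = 0"
  by (simp_all add: dot_def)

lemma dot_delta_left: "finite X \<Longrightarrow> e \<in> X \<Longrightarrow> dot X (\<lambda>c. if e = c then x else 0) v = x * v e"
  by (simp add: dot_def if_distrib[of "\<lambda>a. a * _"] sum.delta cong: if_cong)

lemma dot_delta_right: "finite X \<Longrightarrow> e \<in> X \<Longrightarrow> dot X a (\<lambda>c. if c = e then x else 0) = a e * x"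
  by (simp add: dot_def if_distrib[of "\<lambda>b. _ * b"] sum.delta cong: if_cong)

text \<open>Associativity of the matrix product, a(bw) = (ab)w.\<close>

lemma dot_dot_right: "dot X a (\<lambda>c. dot Y (b c) w) = dot Y (\<lambda>e. dot X a (\<lambda>c. b c e)) w"
proof -
  have "dot X a (\<lambda>c. dot Y (b c) w) = (\<Sum>c\<in>X. \<Sum>e\<in>Y. a c * b c e * w e)"
    by (simp add: dot_def sum_distrib_left ac_simps)
  also have "\<dots> = (\<Sum>e\<in>Y. \<Sum>c\<in>X. a c * b c e * w e)"
    by (rule sum.swap)
  finally show ?thesis by (simp add: dot_def sum_distrib_right)
qed

lemma dot_image: "inj f \<Longrightarrow> dot (f ` X) a v = dot X (\<lambda>c. a (f c)) (\<lambda>c. v (f c))"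
  unfolding dot_def by (subst sum.reindex) (auto simp: inj_on_def)

lemma dot_union: "finite X \<Longrightarrow> finite Y \<Longrightarrow> X \<inter> Y = {} \<Longrightarrow> dot (X \<union> Y) a v = dot X a v + dot Y a v"
  unfolding dot_def by (rule sum.union_disjoint)

lemma poly_ring_dot:
  "(\<And>c. c \<in> X \<Longrightarrow> a c \<in> poly_ring n) \<Longrightarrow> (\<And>c. c \<in> X \<Longrightarrow> v c \<in> poly_ring n) \<Longrightarrow> dot X a v \<in> poly_ring n"
  unfolding dot_def by (intro poly_ring_sum poly_ring_mult)

lemma homogeneous_dot:
  "(\<And>c. c \<in> X \<Longrightarrow> homogeneous d (a c)) \<Longrightarrow> (\<And>c. c \<in> X \<Longrightarrow> homogeneous e (v c)) \<Longrightarrow> homogeneous (d + e) (dot X a v)"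
  unfolding dot_def by (intro homogeneous_sum homogeneous_mult)

lemma degree_part_dot:
  "(\<And>c. c \<in> X \<Longrightarrow> homogeneous (int d) (a c)) \<Longrightarrow> degree_part (d + e) (dot X a v) = dot X a (\<lambda>c. degree_part e (v c))"
  unfolding dot_def by (simp add: degree_part_sum degree_part_mult)

text \<open>Index set of bases: the type contains three disjoint copies of itself, so that it also
  indexes the bases of a mapping cone.\<close>

datatype ix = Point | Old ix | New ix | Shift ix

lemma inj_ix: "inj Old" "inj New" "inj Shift"
  by (auto simp: inj_def)

text \<open>A linear free resolution in which the basis \<open>B i\<close> has degree
  \<open>d + i\<close>, and \<open>\<phi> i\<close> maps the module on \<open>B (Suc i)\<close> to
  that on \<open>B i\<close>. \<open>cycle\<close> is fixed by \<open>defines\<close>: it is the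
  kernel of the augmentation for \<open>i = 0\<close> and of \<open>\<phi> (i - 1)\<close>
  otherwise, so that exactness has one form in all steps.\<close>

locale linear_res =
  fixes n d :: nat and J :: "'k::field mpoly set"
    and B :: "nat \<Rightarrow> ix set" and \<epsilon> :: "ix \<Rightarrow> 'k mpoly" and \<phi> :: "nat \<Rightarrow> ix \<Rightarrow> ix \<Rightarrow> 'k mpoly"
    and cycle :: "nat \<Rightarrow> (ix \<Rightarrow> 'k mpoly) \<Rightarrow> bool"
  defines "cycle \<equiv> \<lambda>i v. case i of 0 \<Rightarrow> dot (B 0) \<epsilon> v = 0 | Suc j \<Rightarrow> \<forall>r\<in>B j. dot (B i) (\<phi> j r) v = 0"
  assumes finite_B: "finite (B i)"
    and gen_ring: "c \<in> B 0 \<Longrightarrow> \<epsilon> c \<in> poly_ring n"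
    and gen_hom: "c \<in> B 0 \<Longrightarrow> homogeneous (int d) (\<epsilon> c)"
    and map_ring: "r \<in> B i \<Longrightarrow> c \<in> B (Suc i) \<Longrightarrow> \<phi> i r c \<in> poly_ring n"
    and map_hom: "r \<in> B i \<Longrightarrow> c \<in> B (Suc i) \<Longrightarrow> homogeneous 1 (\<phi> i r c)"
    and image: "J = {dot (B 0) \<epsilon> v | v. \<forall>c. v c \<in> poly_ring n}"
    and complex: "e \<in> B (Suc i) \<Longrightarrow> cycle i (\<lambda>c. \<phi> i c e)"
    and exact: "\<forall>c\<in>B i. v c \<in> poly_ring n \<Longrightarrow> cycle i v \<Longrightarrow>
        \<exists>w. (\<forall>e. w e \<in> poly_ring n) \<and> (\<forall>c\<in>B i. v c = dot (B (Suc i)) (\<phi> i c) w)"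
begin

lemma cycle_0: "cycle 0 v \<longleftrightarrow> dot (B 0) \<epsilon> v = 0"
  and cycle_Suc: "cycle (Suc j) v \<longleftrightarrow> (\<forall>r\<in>B j. dot (B (Suc j)) (\<phi> j r) v = 0)"
  by (simp_all add: cycle_def)

lemma cycle_boundary: "cycle i (\<lambda>c. dot (B (Suc i)) (\<phi> i c) w)"
proof (cases i)
  case 0
  have "dot (B 0) \<epsilon> (\<lambda>c. \<phi> 0 c e) = 0" if "e \<in> B (Suc 0)" for e
    using complex[of e 0] that by (simp add: cycle_0)
  then have "dot (B (Suc 0)) (\<lambda>e. dot (B 0) \<epsilon> (\<lambda>c. \<phi> 0 c e)) w = dot (B (Suc 0)) (\<lambda>e. 0) w"
    by (intro dot_cong) auto
  then show ?thesis by (simp add: 0 cycle_0 dot_dot_right)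
next
  case (Suc j)
  have "dot (B i) (\<phi> j r) (\<lambda>c. \<phi> i c e) = 0" if "e \<in> B (Suc i)" "r \<in> B j" for e r
    using complex[of e i] that by (simp add: Suc cycle_Suc)
  then have "dot (B (Suc i)) (\<lambda>e. dot (B i) (\<phi> j r) (\<lambda>c. \<phi> i c e)) w = dot (B (Suc i)) (\<lambda>e. 0) w"
     if "r \<in> B j" for r
    using that by (intro dot_cong) auto
  then show ?thesis by (simp add: Suc cycle_Suc dot_dot_right)
qed

text \<open>Any lift has coefficients whose components of degree \<open>e\<close> already form a
  lift, because the generators are homogeneous of degree \<open>d\<close>.\<close>

lemma lift_image:
  assumes "f \<in> J" "homogeneous (int (d + e)) f"
  shows "\<exists>w. (\<forall>c. w c \<in> poly_ring n) \<and> (\<forall>c. homogeneous (int e) (w c)) \<and> f = dot (B 0) \<epsilon> w"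
proof -
  from assms(1) image obtain v where v: "f = dot (B 0) \<epsilon> v" "\<And>c. v c \<in> poly_ring n" by auto
  have "f = degree_part (d + e) f" using assms(2) by (simp only: degree_part_homogeneous)
  also have "\<dots> = dot (B 0) \<epsilon> (\<lambda>c. degree_part e (v c))"
    unfolding v(1) by (rule degree_part_dot) (rule gen_hom)
  finally show ?thesis using v(2)
    by (intro exI[of _ "\<lambda>c. degree_part e (v c)"]) (auto intro: poly_ring_degree_part homogeneous_degree_part)
qed

text \<open>The graded form of \<open>exact\<close>. Its use is with \<open>e = 1\<close>: quadratic
  cycles lift to linear vectors.\<close>

lemma lift_cycle:
  assumes "\<forall>c\<in>B i. v c \<in> poly_ring n" "\<forall>c\<in>B i. homogeneous (int (Suc e)) (v c)" "cycle i v"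
  shows "\<exists>w. (\<forall>c. w c \<in> poly_ring n) \<and> (\<forall>c. homogeneous (int e) (w c)) \<and>
           (\<forall>c\<in>B i. v c = dot (B (Suc i)) (\<phi> i c) w)"
proof -
  from exact[OF assms(1,3)] obtain w where w: "\<And>e. w e \<in> poly_ring n"
    "\<And>c. c \<in> B i \<Longrightarrow> v c = dot (B (Suc i)) (\<phi> i c) w" by blast
  have "v c = dot (B (Suc i)) (\<phi> i c) (\<lambda>e'. degree_part e (w e'))" if c: "c \<in> B i" for c
  proof -
    have "v c = degree_part (1 + e) (v c)" using assms(2) c by (simp add: degree_part_homogeneous)
    also have "\<dots> = dot (B (Suc i)) (\<phi> i c) (\<lambda>e'. degree_part e (w e'))"
      unfolding w(2)[OF c] by (rule degree_part_dot) (use map_hom[OF c] in simp)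
    finally show ?thesis .
  qed
  then show ?thesis using w(1)
    by (intro exI[of _ "\<lambda>c. degree_part e (w c)"]) (auto intro: poly_ring_degree_part homogeneous_degree_part)
qed

end

text \<open>\<open>J\<close> starts one degree above \<open>Q\<close>. Hence \<open>J\<close> and
  \<open>x\<close> times \<open>Q\<close> are generated in the same degree, and the inclusion of
  \<open>J\<close> into \<open>Q\<close> lifts to a chain map with linear entries.\<close>

locale linear_cone =
  J: linear_res n "Suc d" J B \<epsilon> \<phi> bcycle + Q: linear_res n d Q C \<eta> \<psi> ccycle
  for n d and J Q :: "'k::field mpoly set" and B \<epsilon> \<phi> bcycle C \<eta> \<psi> ccycle +
  fixes x :: "'k mpoly"
  assumes sub: "J \<subseteq> Q" and x_nonzero: "x \<noteq> 0" and x_ring: "x \<in> poly_ring n" and x_hom: "homogeneous 1 x"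
    and regular: "f \<in> poly_ring n \<Longrightarrow> x * f \<in> J \<Longrightarrow> f \<in> J"
begin

section \<open>Lifting the inclusion of J into Q to a linear chain map\<close>

lemma chain_map_0: "\<exists>a. (\<forall>r c. a r c \<in> poly_ring n \<and> homogeneous 1 (a r c)) \<and> (\<forall>c\<in>B 0. dot (C 0) \<eta> (\<lambda>r. a r c) = \<epsilon> c)"
proof -
  have "\<exists>w. (\<forall>r. w r \<in> poly_ring n) \<and> (\<forall>r. homogeneous (int 1) (w r)) \<and> (c \<in> B 0 \<longrightarrow> \<epsilon> c = dot (C 0) \<eta> w)" for c
  proof (cases "c \<in> B 0")
    case True
    have "\<epsilon> c = dot (B 0) \<epsilon> (\<lambda>c'. if c' = c then 1 else 0)"
      using True J.finite_B by (simp add: dot_delta_right)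
    then have "\<epsilon> c \<in> J" unfolding J.image by (auto intro!: exI[of _ "\<lambda>c'. if c' = c then 1 else 0"])
    then show ?thesis using sub Q.lift_image[of "\<epsilon> c" 1] J.gen_hom[OF True] by auto
  qed (auto intro!: exI[of _ "\<lambda>_. 0"])
  then obtain w where w: "\<forall>c. (\<forall>r. w c r \<in> poly_ring n) \<and> (\<forall>r. homogeneous (int 1) (w c r)) \<and> (c \<in> B 0 \<longrightarrow> \<epsilon> c = dot (C 0) \<eta> (w c))"
    by metis
  then show ?thesis
    by (intro exI[of _ "\<lambda>r c. w c r"]) auto
qed

definition commutes :: "nat \<Rightarrow> (ix \<Rightarrow> ix \<Rightarrow> 'k mpoly) \<Rightarrow> (ix \<Rightarrow> ix \<Rightarrow> 'k mpoly) \<Rightarrow> bool" where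
  "commutes i a b \<longleftrightarrow> (\<forall>c\<in>B (Suc i). \<forall>r\<in>C i.
      dot (C (Suc i)) (\<psi> i r) (\<lambda>s. b s c) = dot (B i) (a r) (\<lambda>s. \<phi> i s c))"

text \<open>The composite of \<open>a\<close> with \<open>\<phi> i\<close> is quadratic, being a
  product of two linear matrices, and its columns are cycles; lifting them through the linear
  \<open>\<psi> i\<close> leaves linear entries.\<close>

lemma chain_map_step:
  assumes ring: "\<And>r c. a r c \<in> poly_ring n" and hom: "\<And>r c. homogeneous 1 (a r c)"
    and cyc: "\<And>c. c \<in> B (Suc i) \<Longrightarrow> ccycle i (\<lambda>r. dot (B i) (a r) (\<lambda>s. \<phi> i s c))"
  shows "\<exists>b. (\<forall>r c. b r c \<in> poly_ring n \<and> homogeneous 1 (b r c)) \<and> commutes i a b"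
proof -
  have "\<exists>w. (\<forall>r. w r \<in> poly_ring n) \<and> (\<forall>r. homogeneous (int 1) (w r)) \<and>
     (c \<in> B (Suc i) \<longrightarrow> (\<forall>r\<in>C i. dot (B i) (a r) (\<lambda>s. \<phi> i s c) = dot (C (Suc i)) (\<psi> i r) w))" for c
  proof (cases "c \<in> B (Suc i)")
    case True
    have "homogeneous (1 + 1) (dot (B i) (a r) (\<lambda>s. \<phi> i s c))" for r
      using hom J.map_hom True by (intro homogeneous_dot) auto
    moreover have "dot (B i) (a r) (\<lambda>s. \<phi> i s c) \<in> poly_ring n" for r
      using ring J.map_ring True by (intro poly_ring_dot) auto
    ultimately have "\<exists>w. (\<forall>r. w r \<in> poly_ring n) \<and> (\<forall>r. homogeneous (int 1) (w r)) \<and>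
       (\<forall>r\<in>C i. dot (B i) (a r) (\<lambda>s. \<phi> i s c) = dot (C (Suc i)) (\<psi> i r) w)"
      using cyc[OF True] by (intro Q.lift_cycle) simp_all
    then show ?thesis by blast
  qed (auto intro!: exI[of _ "\<lambda>_. 0"])
  then obtain w where "\<forall>c. (\<forall>r. w c r \<in> poly_ring n) \<and> (\<forall>r. homogeneous (int 1) (w c r)) \<and>
     (c \<in> B (Suc i) \<longrightarrow> (\<forall>r\<in>C i. dot (B i) (a r) (\<lambda>s. \<phi> i s c) = dot (C (Suc i)) (\<psi> i r) (w c)))"
    by metis
  then show ?thesis by (intro exI[of _ "\<lambda>r c. w c r"]) (auto simp: commutes_def)
qed

lemma cycle_comp_0:
  assumes a: "\<forall>c\<in>B 0. dot (C 0) \<eta> (\<lambda>r. a r c) = \<epsilon> c" and c: "c \<in> B (Suc 0)"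
  shows "ccycle 0 (\<lambda>r. dot (B 0) (a r) (\<lambda>s. \<phi> 0 s c))"
proof -
  have "dot (C 0) \<eta> (\<lambda>r. dot (B 0) (a r) (\<lambda>s. \<phi> 0 s c)) = dot (B 0) \<epsilon> (\<lambda>s. \<phi> 0 s c)"
    unfolding dot_dot_right using a by (intro dot_cong) auto
  also have "\<dots> = 0" using J.complex[OF c] by (simp add: J.cycle_0)
  finally show ?thesis by (simp add: Q.cycle_0)
qed

lemma cycle_comp_Suc:
  assumes ab: "commutes i a b" and c: "c \<in> B (Suc (Suc i))"
  shows "ccycle (Suc i) (\<lambda>r. dot (B (Suc i)) (b r) (\<lambda>s. \<phi> (Suc i) s c))"
proof -
  have "dot (C (Suc i)) (\<psi> i r) (\<lambda>s. dot (B (Suc i)) (b s) (\<lambda>s. \<phi> (Suc i) s c)) = 0" if r: "r \<in> C i" for r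
  proof -
    have "dot (C (Suc i)) (\<psi> i r) (\<lambda>s. dot (B (Suc i)) (b s) (\<lambda>s. \<phi> (Suc i) s c)) =
       dot (B (Suc i)) (\<lambda>e. dot (B i) (a r) (\<lambda>s. \<phi> i s e)) (\<lambda>s. \<phi> (Suc i) s c)"
      unfolding dot_dot_right using ab r by (intro dot_cong) (auto simp: commutes_def)
    also have "\<dots> = dot (B i) (a r) (\<lambda>s. dot (B (Suc i)) (\<phi> i s) (\<lambda>s. \<phi> (Suc i) s c))"
      by (simp add: dot_dot_right)
    also have "\<dots> = dot (B i) (a r) (\<lambda>s. 0)"
      using J.complex[OF c] by (intro dot_cong) (auto simp: J.cycle_Suc)
    finally show ?thesis by simp
  qed
  then show ?thesis by (simp add: Q.cycle_Suc)
qed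

lemma chain_map:
  obtains \<alpha> where "\<And>i r c. \<alpha> i r c \<in> poly_ring n" "\<And>i r c. homogeneous 1 (\<alpha> i r c)"
    "\<And>c. c \<in> B 0 \<Longrightarrow> dot (C 0) \<eta> (\<lambda>r. \<alpha> 0 r c) = \<epsilon> c"
    "\<And>i. commutes i (\<alpha> i) (\<alpha> (Suc i))"
proof -
  \<comment> \<open>The last conjunct is the cycle condition that \<open>chain_map_step\<close>
    demands. Carrying it in the invariant lets dependent choice continue from step to step.\<close>
  define P where "P i a \<longleftrightarrow> (\<forall>r c. a r c \<in> poly_ring n \<and> homogeneous 1 (a r c)) \<and>
     (i = 0 \<longrightarrow> (\<forall>c\<in>B 0. dot (C 0) \<eta> (\<lambda>r. a r c) = \<epsilon> c)) \<and>
     (\<forall>c\<in>B (Suc i). ccycle i (\<lambda>r. dot (B i) (a r) (\<lambda>s. \<phi> i s c)))" for i a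
  have "\<exists>a. P 0 a"
  proof -
    obtain a where "\<forall>r c. a r c \<in> poly_ring n \<and> homogeneous 1 (a r c)"
      "\<forall>c\<in>B 0. dot (C 0) \<eta> (\<lambda>r. a r c) = \<epsilon> c" using chain_map_0 by blast
    then show ?thesis using cycle_comp_0[of a] unfolding P_def by blast
  qed
  moreover have "\<exists>b. P (Suc i) b \<and> commutes i a b" if Pa: "P i a" for i a
  proof -
    obtain b where "\<forall>r c. b r c \<in> poly_ring n \<and> homogeneous 1 (b r c)" "commutes i a b"
      using chain_map_step[of a i] Pa unfolding P_def by blast
    then show ?thesis using cycle_comp_Suc[of i a b] unfolding P_def by auto
  qed
  ultimately obtain \<alpha> where "\<forall>i. P i (\<alpha> i) \<and> commutes i (\<alpha> i) (\<alpha> (Suc i))"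
    using dependent_nat_choice[of P commutes] by blast
  then show ?thesis by (intro that[of \<alpha>]) (auto simp: P_def)
qed

end

locale linear_cone_map = linear_cone +
  fixes \<alpha> :: "nat \<Rightarrow> ix \<Rightarrow> ix \<Rightarrow> 'a mpoly"
  assumes \<alpha>_ring: "\<alpha> i r c \<in> poly_ring n" and \<alpha>_hom: "homogeneous 1 (\<alpha> i r c)"
    and \<alpha>_0: "c \<in> B 0 \<Longrightarrow> dot (C 0) \<eta> (\<lambda>r. \<alpha> 0 r c) = \<epsilon> c"
    and \<alpha>_Suc: "commutes i (\<alpha> i) (\<alpha> (Suc i))"
begin

text \<open>In step \<open>i\<close> the cone is $F_i \oplus K_i \oplus F_{i-1}$, where $F$ resolves \<open>J\<close>, $K$ resolves \<open>Q\<close>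
  and $F_{-1} = 0$.  Thus no row is labelled \<open>Shift\<close> in \<open>cone_map 0\<close>, and the truncated \<open>i - 1\<close> is harmless.\<close>

definition cone_basis :: "nat \<Rightarrow> ix set" where
  "cone_basis i = Old ` B i \<union> New ` C i \<union> Shift ` (case i of 0 \<Rightarrow> {} | Suc j \<Rightarrow> B j)"

fun cone_gen :: "ix \<Rightarrow> 'a mpoly" where
  "cone_gen (Old c) = \<epsilon> c"
| "cone_gen (New c) = x * \<eta> c"
| "cone_gen _ = 0"

text \<open>The \<open>Shift\<close> columns lift the map xJ \<rightarrow> J \<oplus> xQ, xf
  \<mapsto> (xf, -xf): multiplication by \<open>x\<close> into the \<open>Old\<close> part and
  \<open>-\<alpha>\<close> into the \<open>New\<close> part, whose generators
  \<open>x * \<eta> c\<close> already contain the factor \<open>x\<close>. The sign at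
  \<open>\<phi> (i - 1)\<close> makes consecutive maps compose to zero.\<close>

fun cone_map :: "nat \<Rightarrow> ix \<Rightarrow> ix \<Rightarrow> 'a mpoly" where
  "cone_map i (Old r) (Old c) = \<phi> i r c"
| "cone_map i (Old r) (Shift c) = (if r = c then x else 0)"
| "cone_map i (New r) (New c) = \<psi> i r c"
| "cone_map i (New r) (Shift c) = - \<alpha> i r c"
| "cone_map i (Shift r) (Shift c) = - \<phi> (i - 1) r c"
| "cone_map i _ _ = 0"

definition "cone_cycle \<equiv> \<lambda>i v. case i of 0 \<Rightarrow> dot (cone_basis 0) cone_gen v = 0
     | Suc j \<Rightarrow> \<forall>r\<in>cone_basis j. dot (cone_basis i) (cone_map j r) v = 0"

lemma finite_cone_basis: "finite (cone_basis i)"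
  by (auto simp: cone_basis_def J.finite_B Q.finite_B split: nat.split)

lemma dot_cone_basis_Suc: "dot (cone_basis (Suc i)) a v =
    dot (B (Suc i)) (\<lambda>c. a (Old c)) (\<lambda>c. v (Old c)) + dot (C (Suc i)) (\<lambda>c. a (New c)) (\<lambda>c. v (New c)) +
    dot (B i) (\<lambda>c. a (Shift c)) (\<lambda>c. v (Shift c))"
  unfolding cone_basis_def
  by (subst dot_union, (auto simp: J.finite_B Q.finite_B)[3], subst dot_union)
     (auto simp: J.finite_B Q.finite_B dot_image inj_ix)

lemma dot_cone_basis_0: "dot (cone_basis 0) a v =
    dot (B 0) (\<lambda>c. a (Old c)) (\<lambda>c. v (Old c)) + dot (C 0) (\<lambda>c. a (New c)) (\<lambda>c. v (New c))"
  unfolding cone_basis_def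
  by (subst dot_union, (auto simp: J.finite_B Q.finite_B)[3], subst dot_union)
     (auto simp: J.finite_B Q.finite_B dot_image inj_ix)

lemma ball_cone_basis: "(\<forall>r\<in>cone_basis i. P r) \<longleftrightarrow> (\<forall>r\<in>B i. P (Old r)) \<and> (\<forall>r\<in>C i. P (New r)) \<and>
    (case i of 0 \<Rightarrow> True | Suc j \<Rightarrow> \<forall>r\<in>B j. P (Shift r))"
  by (auto simp: cone_basis_def split: nat.splits)

lemma dot_cone_map:
  "r \<in> B i \<Longrightarrow> dot (cone_basis (Suc i)) (cone_map i (Old r)) v =
      dot (B (Suc i)) (\<phi> i r) (\<lambda>c. v (Old c)) + x * v (Shift r)"
  "dot (cone_basis (Suc i)) (cone_map i (New r)) v =
      dot (C (Suc i)) (\<psi> i r) (\<lambda>c. v (New c)) - dot (B i) (\<alpha> i r) (\<lambda>c. v (Shift c))"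
  "dot (cone_basis (Suc i)) (cone_map i (Shift r)) v = - dot (B i) (\<phi> (i - 1) r) (\<lambda>c. v (Shift c))"
  by (simp_all add: dot_cone_basis_Suc dot_delta_left J.finite_B dot_uminus_left)

lemma cone_cycle_0: "cone_cycle 0 v \<longleftrightarrow>
    dot (B 0) \<epsilon> (\<lambda>c. v (Old c)) + x * dot (C 0) \<eta> (\<lambda>c. v (New c)) = 0"
  by (simp add: cone_cycle_def dot_cone_basis_0 dot_scale_left)

lemma cone_cycle_Suc: "cone_cycle (Suc j) v \<longleftrightarrow>
    (\<forall>r\<in>B j. dot (B (Suc j)) (\<phi> j r) (\<lambda>c. v (Old c)) + x * v (Shift r) = 0) \<and>
    (\<forall>r\<in>C j. dot (C (Suc j)) (\<psi> j r) (\<lambda>c. v (New c)) = dot (B j) (\<alpha> j r) (\<lambda>c. v (Shift c))) \<and>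
    bcycle j (\<lambda>c. v (Shift c))"  (is "_ \<longleftrightarrow> ?A \<and> ?B \<and> ?C")
proof -
  \<comment> \<open>For \<open>j = 0\<close> no row tests the \<open>Shift\<close> component.
    Applying \<open>\<epsilon>\<close> to the first condition removes the boundary and leaves
    \<open>x\<close> times the wanted value, and \<open>x\<close> is a nonzero element of a
    domain.\<close>
  have C: "?C" if "?A" and "j = 0"
  proof -
    have "0 = dot (B 0) \<epsilon> (\<lambda>r. dot (B (Suc 0)) (\<phi> 0 r) (\<lambda>c. v (Old c)) + x * v (Shift r))"
      using that by (subst dot_cong[where b = \<epsilon> and w = "\<lambda>_. 0"]) auto
    also have "\<dots> = x * dot (B 0) \<epsilon> (\<lambda>r. v (Shift r))"
      using J.cycle_boundary[of 0 "\<lambda>c. v (Old c)"]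
      by (simp add: dot_add_right dot_scale_right J.cycle_0)
    finally show ?thesis using x_nonzero that by (simp add: J.cycle_0)
  qed
  show ?thesis
  proof (cases j)
    case 0
    then show ?thesis using C
      by (auto simp: cone_cycle_def ball_cone_basis dot_cone_map)
  next
    case (Suc k)
    then show ?thesis
      by (simp add: cone_cycle_def ball_cone_basis dot_cone_map J.cycle_Suc)
  qed
qed

lemma cone_complex:
  assumes e: "e \<in> cone_basis (Suc i)"
  shows "cone_cycle i (\<lambda>c. cone_map i c e)"
proof -
  consider (Old) e' where "e = Old e'" "e' \<in> B (Suc i)" | (New) e' where "e = New e'" "e' \<in> C (Suc i)"
    | (Shift) e' where "e = Shift e'" "e' \<in> B i"
    using e by (auto simp: cone_basis_def)
  then show ?thesis
  proof cases
    case Old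
    show ?thesis
    proof (cases i)
      case 0
      then show ?thesis using J.complex[OF Old(2)] by (simp add: Old cone_cycle_0 J.cycle_0)
    next
      case (Suc j)
      have "bcycle j (\<lambda>c. 0)" by (cases j) (auto simp: J.cycle_0 J.cycle_Suc)
      then show ?thesis using J.complex[OF Old(2)] by (simp add: Old Suc cone_cycle_Suc J.cycle_Suc)
    qed
  next
    case New
    show ?thesis
    proof (cases i)
      case 0
      then show ?thesis using Q.complex[OF New(2)] by (simp add: New cone_cycle_0 Q.cycle_0)
    next
      case (Suc j)
      have "bcycle j (\<lambda>c. 0)" by (cases j) (auto simp: J.cycle_0 J.cycle_Suc)
      then show ?thesis using Q.complex[OF New(2)] by (simp add: New Suc cone_cycle_Suc Q.cycle_Suc)
    qed
  next
    case Shift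
    show ?thesis
    proof (cases i)
      case 0
      then show ?thesis using Shift(2) \<alpha>_0[of e']
        by (simp add: Shift cone_cycle_0 dot_delta_right J.finite_B dot_uminus_right)
    next
      case (Suc j)
      have "bcycle j (\<lambda>c. - \<phi> j c e')"
        using J.complex[of e' j] Shift(2) Suc
        by (cases j) (auto simp: J.cycle_0 J.cycle_Suc dot_uminus_right)
      then show ?thesis using Shift(2) \<alpha>_Suc[of j]
        by (auto simp: Shift Suc cone_cycle_Suc dot_delta_right J.finite_B dot_uminus_right commutes_def)
    qed
  qed
qed

section \<open>Exactness of the cone\<close>

definition cone_vec :: "(ix \<Rightarrow> 'a mpoly) \<Rightarrow> (ix \<Rightarrow> 'a mpoly) \<Rightarrow> (ix \<Rightarrow> 'a mpoly) \<Rightarrow> ix \<Rightarrow> 'a mpoly" where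
  "cone_vec f g h c = (case c of Old c \<Rightarrow> f c | New c \<Rightarrow> g c | Shift c \<Rightarrow> h c | Point \<Rightarrow> 0)"

lemma cone_vec_simps [simp]:
  "cone_vec f g h (Old c) = f c" "cone_vec f g h (New c) = g c" "cone_vec f g h (Shift c) = h c"
  by (simp_all add: cone_vec_def)

lemma cone_vec_ring: "(\<And>c. f c \<in> poly_ring n) \<Longrightarrow> (\<And>c. g c \<in> poly_ring n) \<Longrightarrow> (\<And>c. h c \<in> poly_ring n) \<Longrightarrow>
    cone_vec f g h c \<in> poly_ring n"
  by (simp add: cone_vec_def split: ix.split)

text \<open>A cycle makes \<open>x * q\<close> an element of \<open>J\<close>, where
  \<open>q\<close> is the image of its \<open>New\<close> part in \<open>Q\<close>. Regularity of
  \<open>x\<close> modulo \<open>J\<close> enters here: it puts \<open>q\<close> in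
  \<open>J\<close>, say with coefficients \<open>f\<close>. Correcting the \<open>Old\<close> part
  by \<open>x * f\<close> and the \<open>New\<close> part by \<open>\<alpha> 0\<close> applied to
  \<open>f\<close> gives cycles of the two given resolutions; their preimages \<open>g\<close> and
  \<open>h\<close> together with \<open>- f\<close> form the required preimage.\<close>

lemma cone_exact_0:
  assumes ring: "\<forall>c\<in>cone_basis 0. v c \<in> poly_ring n" and cyc: "cone_cycle 0 v"
  shows "\<exists>w. (\<forall>e. w e \<in> poly_ring n) \<and> (\<forall>c\<in>cone_basis 0. v c = dot (cone_basis (Suc 0)) (cone_map 0 c) w)"
proof -
  have vL: "v (Old c) \<in> poly_ring n" if "c \<in> B 0" for c using that ring by (simp add: cone_basis_def)
  have vM: "v (New c) \<in> poly_ring n" if "c \<in> C 0" for c using that ring by (simp add: cone_basis_def)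
  define q where "q = dot (C 0) \<eta> (\<lambda>c. v (New c))"
  have eq: "dot (B 0) \<epsilon> (\<lambda>c. v (Old c)) = - (x * q)"
    using cyc by (simp add: cone_cycle_0 q_def eq_neg_iff_add_eq_0)
  have q: "q \<in> poly_ring n" unfolding q_def using Q.gen_ring vM by (intro poly_ring_dot) auto
  have "dot (B 0) \<epsilon> (\<lambda>c. if c \<in> B 0 then - v (Old c) else 0) = x * q"
    using eq by (subst dot_cong[where b = \<epsilon> and w = "\<lambda>c. - v (Old c)"]) (auto simp: dot_uminus_right)
  then have "x * q \<in> J" unfolding J.image using vL
    by (auto intro!: exI[of _ "\<lambda>c. if c \<in> B 0 then - v (Old c) else 0"] poly_ring_uminus)
  then have "q \<in> J" using regular q by blast
  then obtain f where f: "q = dot (B 0) \<epsilon> f" "\<And>c. f c \<in> poly_ring n" unfolding J.image by auto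
  have "bcycle 0 (\<lambda>c. v (Old c) + x * f c)"
    using eq by (simp add: J.cycle_0 dot_add_right dot_scale_right f(1))
  moreover have "\<forall>c\<in>B 0. v (Old c) + x * f c \<in> poly_ring n"
    using vL f(2) x_ring by (auto intro: poly_ring_add poly_ring_mult)
  ultimately have "\<exists>w. (\<forall>e. w e \<in> poly_ring n) \<and> (\<forall>c\<in>B 0. v (Old c) + x * f c = dot (B (Suc 0)) (\<phi> 0 c) w)"
    by (intro J.exact)
  then obtain g where g: "\<And>c. g c \<in> poly_ring n"
      "\<And>c. c \<in> B 0 \<Longrightarrow> v (Old c) + x * f c = dot (B (Suc 0)) (\<phi> 0 c) g" by blast
  have "dot (C 0) \<eta> (\<lambda>r. dot (B 0) (\<alpha> 0 r) f) = q"
    unfolding dot_dot_right f(1) using \<alpha>_0 by (intro dot_cong) auto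
  then have "ccycle 0 (\<lambda>r. v (New r) - dot (B 0) (\<alpha> 0 r) f)"
    by (simp add: Q.cycle_0 dot_diff_right q_def)
  moreover have "\<forall>c\<in>C 0. v (New c) - dot (B 0) (\<alpha> 0 c) f \<in> poly_ring n"
    using vM f(2) \<alpha>_ring by (auto intro!: poly_ring_diff poly_ring_dot)
  ultimately have "\<exists>w. (\<forall>e. w e \<in> poly_ring n) \<and> (\<forall>c\<in>C 0. v (New c) - dot (B 0) (\<alpha> 0 c) f = dot (C (Suc 0)) (\<psi> 0 c) w)"
    by (intro Q.exact)
  then obtain h where h: "\<And>c. h c \<in> poly_ring n"
      "\<And>c. c \<in> C 0 \<Longrightarrow> v (New c) - dot (B 0) (\<alpha> 0 c) f = dot (C (Suc 0)) (\<psi> 0 c) h" by blast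
  have "\<forall>c\<in>cone_basis 0. v c = dot (cone_basis (Suc 0)) (cone_map 0 c) (cone_vec g h (\<lambda>c. - f c))"
    by (simp add: ball_cone_basis dot_cone_map g(2)[symmetric] h(2)[symmetric] dot_uminus_right)
  then show ?thesis using g(1) h(1) f(2)
    by (intro exI[of _ "cone_vec g h (\<lambda>c. - f c)"]) (auto intro!: cone_vec_ring poly_ring_uminus)
qed

text \<open>The same diagram chase as in step zero, except that \<open>f\<close> is now a preimage
  of the \<open>Shift\<close> part of the cycle under \<open>\<phi> j\<close>, supplied by exactness
  of the resolution of \<open>J\<close>.\<close>

lemma cone_exact_Suc:
  assumes ring: "\<forall>c\<in>cone_basis (Suc j). v c \<in> poly_ring n" and cyc: "cone_cycle (Suc j) v"
  shows "\<exists>w. (\<forall>e. w e \<in> poly_ring n) \<and>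
     (\<forall>c\<in>cone_basis (Suc j). v c = dot (cone_basis (Suc (Suc j))) (cone_map (Suc j) c) w)"
proof -
  have vL: "v (Old c) \<in> poly_ring n" if "c \<in> B (Suc j)" for c using that ring by (simp add: cone_basis_def)
  have vM: "v (New c) \<in> poly_ring n" if "c \<in> C (Suc j)" for c using that ring by (simp add: cone_basis_def)
  have vS: "v (Shift c) \<in> poly_ring n" if "c \<in> B j" for c using that ring by (simp add: cone_basis_def)
  obtain f where f: "\<And>c. f c \<in> poly_ring n" "\<And>c. c \<in> B j \<Longrightarrow> v (Shift c) = dot (B (Suc j)) (\<phi> j c) f"
    using J.exact[of j "\<lambda>c. v (Shift c)"] cyc vS unfolding cone_cycle_Suc by meson
  have "dot (B (Suc j)) (\<phi> j r) (\<lambda>c. v (Old c) + x * f c) = 0" if r: "r \<in> B j" for r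
    using cyc r by (simp add: cone_cycle_Suc dot_add_right dot_scale_right f(2)[OF r, symmetric])
  then have "bcycle (Suc j) (\<lambda>c. v (Old c) + x * f c)" by (simp add: J.cycle_Suc)
  moreover have "\<forall>c\<in>B (Suc j). v (Old c) + x * f c \<in> poly_ring n"
    using vL f(1) x_ring by (auto intro: poly_ring_add poly_ring_mult)
  ultimately have "\<exists>w. (\<forall>e. w e \<in> poly_ring n) \<and> (\<forall>c\<in>B (Suc j). v (Old c) + x * f c = dot (B (Suc (Suc j))) (\<phi> (Suc j) c) w)"
    by (intro J.exact)
  then obtain g where g: "\<And>c. g c \<in> poly_ring n"
      "\<And>c. c \<in> B (Suc j) \<Longrightarrow> v (Old c) + x * f c = dot (B (Suc (Suc j))) (\<phi> (Suc j) c) g" by blast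
  have "dot (C (Suc j)) (\<psi> j r) (\<lambda>s. v (New s) - dot (B (Suc j)) (\<alpha> (Suc j) s) f) = 0" if r: "r \<in> C j" for r
  proof -
    have "dot (C (Suc j)) (\<psi> j r) (\<lambda>s. dot (B (Suc j)) (\<alpha> (Suc j) s) f) =
        dot (B (Suc j)) (\<lambda>e. dot (B j) (\<alpha> j r) (\<lambda>s. \<phi> j s e)) f"
      unfolding dot_dot_right using \<alpha>_Suc[of j] r by (intro dot_cong) (auto simp: commutes_def)
    also have "\<dots> = dot (B j) (\<alpha> j r) (\<lambda>c. v (Shift c))"
      unfolding dot_dot_right[symmetric] using f(2) by (intro dot_cong) auto
    finally show ?thesis using cyc r by (simp add: cone_cycle_Suc dot_diff_right)
  qed
  then have "ccycle (Suc j) (\<lambda>s. v (New s) - dot (B (Suc j)) (\<alpha> (Suc j) s) f)"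
    by (simp add: Q.cycle_Suc)
  moreover have "\<forall>c\<in>C (Suc j). v (New c) - dot (B (Suc j)) (\<alpha> (Suc j) c) f \<in> poly_ring n"
    using vM f(1) \<alpha>_ring by (auto intro!: poly_ring_diff poly_ring_dot)
  ultimately have "\<exists>w. (\<forall>e. w e \<in> poly_ring n) \<and> (\<forall>c\<in>C (Suc j). v (New c) - dot (B (Suc j)) (\<alpha> (Suc j) c) f = dot (C (Suc (Suc j))) (\<psi> (Suc j) c) w)"
    by (intro Q.exact)
  then obtain h where h: "\<And>c. h c \<in> poly_ring n"
      "\<And>c. c \<in> C (Suc j) \<Longrightarrow> v (New c) - dot (B (Suc j)) (\<alpha> (Suc j) c) f = dot (C (Suc (Suc j))) (\<psi> (Suc j) c) h" by blast
  have "\<forall>c\<in>cone_basis (Suc j). v c = dot (cone_basis (Suc (Suc j))) (cone_map (Suc j) c) (cone_vec g h (\<lambda>c. - f c))"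
    by (simp add: ball_cone_basis dot_cone_map g(2)[symmetric] h(2)[symmetric] f(2) dot_uminus_right)
  then show ?thesis using g(1) h(1) f(1)
    by (intro exI[of _ "cone_vec g h (\<lambda>c. - f c)"]) (auto intro!: cone_vec_ring poly_ring_uminus)
qed

lemma cone_linear_res:
  "linear_res n (Suc d) {f + x * g | f g. f \<in> J \<and> g \<in> Q} cone_basis cone_gen cone_map"
proof
  show "finite (cone_basis i)" for i by (rule finite_cone_basis)
  show "cone_gen c \<in> poly_ring n" if "c \<in> cone_basis 0" for c
    using that J.gen_ring Q.gen_ring x_ring by (auto simp: cone_basis_def intro!: poly_ring_mult)
  show "homogeneous (int (Suc d)) (cone_gen c)" if "c \<in> cone_basis 0" for c
    using that J.gen_hom homogeneous_mult[OF x_hom Q.gen_hom] by (auto simp: cone_basis_def)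
  show "cone_map i r c \<in> poly_ring n" if "r \<in> cone_basis i" "c \<in> cone_basis (Suc i)" for i r c
    using that J.map_ring Q.map_ring x_ring \<alpha>_ring
    by (auto simp: cone_basis_def intro!: poly_ring_uminus split: nat.splits)
  show "homogeneous 1 (cone_map i r c)" if "r \<in> cone_basis i" "c \<in> cone_basis (Suc i)" for i r c
    using that J.map_hom Q.map_hom x_hom \<alpha>_hom
    by (auto simp: cone_basis_def intro!: homogeneous_uminus split: nat.splits)
  show "{f + x * g | f g. f \<in> J \<and> g \<in> Q} = {dot (cone_basis 0) cone_gen v | v. \<forall>c. v c \<in> poly_ring n}"
  proof (intro equalityI subsetI)
    fix z assume "z \<in> {f + x * g | f g. f \<in> J \<and> g \<in> Q}"
    then obtain v w where "z = dot (B 0) \<epsilon> v + x * dot (C 0) \<eta> w" "\<And>c. v c \<in> poly_ring n" "\<And>c. w c \<in> poly_ring n"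
      by (auto simp: J.image Q.image)
    then show "z \<in> {dot (cone_basis 0) cone_gen v | v. \<forall>c. v c \<in> poly_ring n}"
      by (auto simp: dot_cone_basis_0 dot_scale_left intro!: exI[of _ "cone_vec v w (\<lambda>_. 0)"] cone_vec_ring)
  next
    fix z assume "z \<in> {dot (cone_basis 0) cone_gen v | v. \<forall>c. v c \<in> poly_ring n}"
    then obtain v where "z = dot (cone_basis 0) cone_gen v" "\<forall>c. v c \<in> poly_ring n" by auto
    then show "z \<in> {f + x * g | f g. f \<in> J \<and> g \<in> Q}"
      unfolding J.image Q.image mem_Collect_eq
      by (intro exI[of _ "dot (B 0) \<epsilon> (\<lambda>c. v (Old c))"] exI[of _ "dot (C 0) \<eta> (\<lambda>c. v (New c))"])
         (auto simp: dot_cone_basis_0 dot_scale_left)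
  qed
  show "case i of 0 \<Rightarrow> dot (cone_basis 0) cone_gen (\<lambda>c. cone_map i c e) = 0
     | Suc j \<Rightarrow> \<forall>r\<in>cone_basis j. dot (cone_basis i) (cone_map j r) (\<lambda>c. cone_map i c e) = 0"
    if "e \<in> cone_basis (Suc i)" for e i
    using cone_complex[OF that] by (simp only: cone_cycle_def)
  show "\<exists>w. (\<forall>e. w e \<in> poly_ring n) \<and> (\<forall>c\<in>cone_basis i. v c = dot (cone_basis (Suc i)) (cone_map i c) w)"
    if "\<forall>c\<in>cone_basis i. v c \<in> poly_ring n"
      "case i of 0 \<Rightarrow> dot (cone_basis 0) cone_gen v = 0
     | Suc j \<Rightarrow> \<forall>r\<in>cone_basis j. dot (cone_basis i) (cone_map j r) v = 0" for i v
    using that cone_exact_0[of v] cone_exact_Suc[of _ v] by (cases i) (simp_all add: cone_cycle_def)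
qed

end

section \<open>Linear resolutions of edge ideals\<close>

context linear_res
begin

text \<open>Enumerating every basis turns functions on labels into vectors. \<open>vec_of\<close>
  and \<open>fun_of\<close> translate both ways, so that image, kernel and exactness carry over from
  the locale.\<close>

lemma has_linear_resolution: "has_linear_resolution n J"
proof -
  define N where "N i = card (B i)" for i
  have "\<exists>h. bij_betw h {0..<N i} (B i)" for i
    unfolding N_def using finite_B by (rule ex_bij_betw_nat_finite)
  then obtain h where h: "bij_betw (h i) {0..<N i} (B i)" for i by metis
  have h_in: "h i c \<in> B i" if "c < N i" for i c
    using bij_betwE[OF h[of i]] that by auto
  define vec_of where "vec_of i w = vec (N i) (\<lambda>c. w (h i c))" for i and w :: "ix \<Rightarrow> 'k mpoly"
  define fun_of where "fun_of i v e = v $ (inv_into {0..<N i} (h i) e)" for i and v :: "'k mpoly vec" and e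
  \<comment> \<open>The index moves by one: \<open>\<Phi> 0\<close> is the row of generators, and
    \<open>\<Phi> (Suc j)\<close> represents \<open>\<phi> j\<close>.\<close>
  define \<Phi> where "\<Phi> i = (case i of 0 \<Rightarrow> mat 1 (N 0) (\<lambda>(r, c). \<epsilon> (h 0 c))
      | Suc j \<Rightarrow> mat (N j) (N i) (\<lambda>(r, c). \<phi> j (h j r) (h i c)))" for i
  have dim [simp]: "dim_row (\<Phi> 0) = 1" "dim_row (\<Phi> (Suc i)) = N i" "dim_col (\<Phi> i) = N i" for i
    by (simp_all add: \<Phi>_def split: nat.split)
  have \<Phi>_0 [simp]: "\<Phi> 0 $$ (0, c) = \<epsilon> (h 0 c)" if "c < N 0" for c
    using that by (simp add: \<Phi>_def)
  have \<Phi>_Suc [simp]: "\<Phi> (Suc i) $$ (r, c) = \<phi> i (h i r) (h (Suc i) c)" if "r < N i" "c < N (Suc i)" for i r c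
    using that by (simp add: \<Phi>_def)
  have dot_eq: "dot (B i) a w = (\<Sum>c = 0..<N i. a (h i c) * w (h i c))" for i a and w :: "ix \<Rightarrow> 'k mpoly"
    unfolding dot_def using h[of i] by (rule sum.reindex_bij_betw[symmetric])
  have vec_fun: "vec_of i (fun_of i v) = v" if "dim_vec v = N i" for i v
    using that h[of i] by (intro eq_vecI) (auto simp: vec_of_def fun_of_def bij_betw_def)
  have vec_dim [simp]: "dim_vec (vec_of i w) = N i" for i w by (simp add: vec_of_def)
  have vec_free: "vec_of i w \<in> free_module n (N i)" if "\<forall>c\<in>B i. w c \<in> poly_ring n" for i w
    using that h_in by (auto simp: free_module_def vec_of_def)
  have fun_ring: "\<forall>c\<in>B i. fun_of i v c \<in> poly_ring n" if "v \<in> free_module n (N i)" for i v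
  proof
    fix c assume "c \<in> B i"
    then have "c \<in> h i ` {0..<N i}" using h[of i] by (simp add: bij_betw_def)
    then have "inv_into {0..<N i} (h i) c \<in> {0..<N i}" by (rule inv_into_into)
    then show "fun_of i v c \<in> poly_ring n" using that by (auto simp: fun_of_def free_module_def)
  qed
  have mult_0: "(\<Phi> 0 *\<^sub>v vec_of 0 w) $ 0 = dot (B 0) \<epsilon> w" for w
    by (simp add: scalar_prod_def dot_eq) (auto simp: vec_of_def intro!: sum.cong)
  have mult_Suc: "\<Phi> (Suc i) *\<^sub>v vec_of (Suc i) w = vec_of i (\<lambda>r. dot (B (Suc i)) (\<phi> i r) w)" for i w
    by (intro eq_vecI) (auto simp: scalar_prod_def dot_eq vec_of_def intro!: sum.cong)
  have vec_0: "vec_of i w = 0\<^sub>v (N i) \<longleftrightarrow> (\<forall>c\<in>B i. w c = 0)" for i w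
    unfolding bij_betw_imp_surj_on[OF h[of i], symmetric] by (auto simp: vec_of_def vec_eq_iff)
  have ker: "\<Phi> i *\<^sub>v vec_of i w = 0\<^sub>v (dim_row (\<Phi> i)) \<longleftrightarrow> cycle i w" for i w
  proof (cases i)
    case 0
    then show ?thesis using mult_0[of w] by (auto simp: vec_eq_iff cycle_0)
  next
    case (Suc j)
    then show ?thesis by (simp add: mult_Suc vec_0 cycle_Suc)
  qed
  have ex: "{v \<in> free_module n (dim_col (\<Phi> i)). \<Phi> i *\<^sub>v v = 0\<^sub>v (dim_row (\<Phi> i))} =
          (\<lambda>v. \<Phi> (Suc i) *\<^sub>v v) ` free_module n (dim_col (\<Phi> (Suc i)))" for i
  proof (intro equalityI subsetI)
    fix v assume "v \<in> {v \<in> free_module n (dim_col (\<Phi> i)). \<Phi> i *\<^sub>v v = 0\<^sub>v (dim_row (\<Phi> i))}"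
    then have v: "v \<in> free_module n (N i)" "\<Phi> i *\<^sub>v v = 0\<^sub>v (dim_row (\<Phi> i))" by auto
    have v_eq: "v = vec_of i (fun_of i v)" using v(1) by (simp add: vec_fun free_module_def)
    with v(2) have "cycle i (fun_of i v)" using ker by metis
    from exact[OF fun_ring[OF v(1)] this] obtain w where w: "\<forall>e. w e \<in> poly_ring n"
      "\<forall>c\<in>B i. fun_of i v c = dot (B (Suc i)) (\<phi> i c) w" by blast
    have "v = \<Phi> (Suc i) *\<^sub>v vec_of (Suc i) w"
      unfolding mult_Suc by (subst v_eq, intro eq_vecI) (use w(2) h_in in \<open>auto simp: vec_of_def\<close>)
    then show "v \<in> (\<lambda>v. \<Phi> (Suc i) *\<^sub>v v) ` free_module n (dim_col (\<Phi> (Suc i)))"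
      using vec_free[of "Suc i" w] w(1) by auto
  next
    fix u assume "u \<in> (\<lambda>v. \<Phi> (Suc i) *\<^sub>v v) ` free_module n (dim_col (\<Phi> (Suc i)))"
    then obtain v where v: "u = \<Phi> (Suc i) *\<^sub>v v" "v \<in> free_module n (N (Suc i))" by auto
    have "v = vec_of (Suc i) (fun_of (Suc i) v)" using v(2) by (simp add: vec_fun free_module_def)
    then have u: "u = vec_of i (\<lambda>r. dot (B (Suc i)) (\<phi> i r) (fun_of (Suc i) v))"
      using v(1) mult_Suc by metis
    have "\<forall>c\<in>B i. dot (B (Suc i)) (\<phi> i c) (fun_of (Suc i) v) \<in> poly_ring n"
      using map_ring fun_ring[OF v(2)] by (auto intro!: poly_ring_dot)
    then have "u \<in> free_module n (N i)" unfolding u by (rule vec_free)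
    moreover have "\<Phi> i *\<^sub>v u = 0\<^sub>v (dim_row (\<Phi> i))"
      unfolding u ker by (rule cycle_boundary)
    ultimately show "u \<in> {v \<in> free_module n (dim_col (\<Phi> i)). \<Phi> i *\<^sub>v v = 0\<^sub>v (dim_row (\<Phi> i))}" by simp
  qed
  have im: "(\<lambda>v. (\<Phi> 0 *\<^sub>v v) $ 0) ` free_module n (dim_col (\<Phi> 0)) = J"
  proof (intro equalityI subsetI)
    fix f assume "f \<in> (\<lambda>v. (\<Phi> 0 *\<^sub>v v) $ 0) ` free_module n (dim_col (\<Phi> 0))"
    then obtain v where v: "f = (\<Phi> 0 *\<^sub>v v) $ 0" "v \<in> free_module n (N 0)" by auto
    have "v = vec_of 0 (fun_of 0 v)" using v(2) by (simp add: vec_fun free_module_def)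
    then have "f = dot (B 0) \<epsilon> (fun_of 0 v)" using v(1) mult_0 by metis
    \<comment> \<open>Outside \<open>B 0\<close> the values of \<open>fun_of\<close> are
      unspecified, whereas \<open>image\<close> asks for ring elements at every label; hence the
      extension by zero.\<close>
    also have "\<dots> = dot (B 0) \<epsilon> (\<lambda>c. if c \<in> B 0 then fun_of 0 v c else 0)"
      by (intro dot_cong) auto
    finally show "f \<in> J" unfolding image using fun_ring[OF v(2)] by auto
  next
    fix f assume "f \<in> J"
    then obtain w where w: "f = dot (B 0) \<epsilon> w" "\<forall>c. w c \<in> poly_ring n" unfolding image by auto
    then have "f = (\<Phi> 0 *\<^sub>v vec_of 0 w) $ 0" by (simp only: mult_0)
    then show "f \<in> (\<lambda>v. (\<Phi> 0 *\<^sub>v v) $ 0) ` free_module n (dim_col (\<Phi> 0))"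
      using vec_free[of 0 w] w(2) by auto
  qed
  have elems_0: "elements_mat (\<Phi> 0) \<subseteq> poly_ring n"
    using gen_ring h_in by (auto simp: elements_mat_def)
  have elems_Suc: "f \<in> poly_ring n \<and> homogeneous 1 f" if "f \<in> elements_mat (\<Phi> (Suc i))" for i f
    using that map_ring map_hom h_in by (auto simp: elements_mat_def)
  have "graded_free_resolution n J \<Phi> (\<lambda>i j. int (d + i))"
    unfolding graded_free_resolution_def
  proof (intro conjI allI impI)
    show "elements_mat (\<Phi> i) \<subseteq> poly_ring n" for i
      using elems_0 elems_Suc by (cases i) auto
    show "homogeneous (int (d + 0)) (\<Phi> 0 $$ (0, c))" if "c < dim_col (\<Phi> 0)" for c
      using that gen_hom h_in by simp
    show "homogeneous (int (d + Suc i) - int (d + i)) (\<Phi> (Suc i) $$ (r, c))"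
      if "r < dim_col (\<Phi> i)" "c < dim_col (\<Phi> (Suc i))" for i r c
      using that map_hom h_in by simp
    show "(\<lambda>v. (\<Phi> 0 *\<^sub>v v) $ 0) ` free_module n (dim_col (\<Phi> 0)) = J" by (rule im)
    show "{v \<in> free_module n (dim_col (\<Phi> i)). \<Phi> i *\<^sub>v v = 0\<^sub>v (dim_row (\<Phi> i))} =
          (\<lambda>v. \<Phi> (Suc i) *\<^sub>v v) ` free_module n (dim_col (\<Phi> (Suc i)))" for i by (rule ex)
  qed simp_all
  then have "minimal_graded_free_resolution n J \<Phi> (\<lambda>i j. int (d + i))"
    unfolding minimal_graded_free_resolution_def using elems_Suc linear_in_irrelevant_ideal by auto
  then show ?thesis unfolding has_linear_resolution_def using elems_Suc by blast
qed

end

definition linear_in_degree :: "nat \<Rightarrow> nat \<Rightarrow> 'k::field mpoly set \<Rightarrow> bool" where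
  "linear_in_degree n d J \<longleftrightarrow> (\<exists>B \<epsilon> \<phi>. linear_res n d J B \<epsilon> \<phi>)"

lemma linear_in_degree_zero: "linear_in_degree n d {0}"
proof -
  have "linear_res n d {0} (\<lambda>_. {}) (\<lambda>_. 0) (\<lambda>_ _ _. 0)"
    by unfold_locales (auto split: nat.split intro!: exI[of _ "\<lambda>_. 0"])
  then show ?thesis unfolding linear_in_degree_def by blast
qed

text \<open>The role of \<open>Q\<close> when a variable is adjoined: J + (x) is the cone of
  \<open>J\<close> and the unit ideal, which is generated in degree 0.\<close>

lemma linear_in_degree_unit: "linear_in_degree n 0 (poly_ring n :: 'k::field mpoly set)"
proof -
  have "linear_res n 0 (poly_ring n :: 'k mpoly set) (\<lambda>i. if i = 0 then {Point} else {}) (\<lambda>_. 1) (\<lambda>_ _ _. 0)"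
  proof
    show "(poly_ring n :: 'k mpoly set) =
      {dot (if 0 = (0::nat) then {Point} else {}) (\<lambda>_. 1) v |v. \<forall>c. v c \<in> poly_ring n}"
      by (auto simp: dot_def)
  qed (auto simp: homogeneous_one dot_def split: nat.splits intro!: exI[of _ "\<lambda>_. 0"])
  then show ?thesis unfolding linear_in_degree_def by blast
qed

lemma linear_in_degree_cone:
  assumes "linear_in_degree n (Suc d) J" "linear_in_degree n d Q" "J \<subseteq> Q"
    and "x \<noteq> 0" "x \<in> poly_ring n" "homogeneous 1 x"
    and "\<And>f. f \<in> poly_ring n \<Longrightarrow> x * f \<in> J \<Longrightarrow> f \<in> J"
  shows "linear_in_degree n (Suc d) {f + x * g | f g. f \<in> J \<and> g \<in> Q}"
proof -
  obtain B \<epsilon> \<phi> where J: "linear_res n (Suc d) J B \<epsilon> \<phi>" using assms unfolding linear_in_degree_def by blast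
  obtain C \<eta> \<psi> where Q: "linear_res n d Q C \<eta> \<psi>" using assms unfolding linear_in_degree_def by blast
  interpret linear_cone n d J Q B \<epsilon> \<phi>
     "\<lambda>i v. case i of 0 \<Rightarrow> dot (B 0) \<epsilon> v = 0 | Suc j \<Rightarrow> \<forall>r\<in>B j. dot (B i) (\<phi> j r) v = 0"
      C \<eta> \<psi> "\<lambda>i v. case i of 0 \<Rightarrow> dot (C 0) \<eta> v = 0 | Suc j \<Rightarrow> \<forall>r\<in>C j. dot (C i) (\<psi> j r) v = 0" x
    by (rule linear_cone.intro[OF J Q linear_cone_axioms.intro[OF assms(3-7)]])
  obtain \<alpha> where \<alpha>: "\<And>i r c. \<alpha> i r c \<in> poly_ring n" "\<And>i r c. homogeneous 1 (\<alpha> i r c)"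
    "\<And>c. c \<in> B 0 \<Longrightarrow> dot (C 0) \<eta> (\<lambda>r. \<alpha> 0 r c) = \<epsilon> c"
    "\<And>i. commutes i (\<alpha> i) (\<alpha> (Suc i))" by (rule chain_map, rule that)
  interpret linear_cone_map n d J Q B \<epsilon> \<phi>
     "\<lambda>i v. case i of 0 \<Rightarrow> dot (B 0) \<epsilon> v = 0 | Suc j \<Rightarrow> \<forall>r\<in>B j. dot (B i) (\<phi> j r) v = 0"
      C \<eta> \<psi> "\<lambda>i v. case i of 0 \<Rightarrow> dot (C 0) \<eta> v = 0 | Suc j \<Rightarrow> \<forall>r\<in>C j. dot (C i) (\<psi> j r) v = 0" x \<alpha>
    by unfold_locales (fact \<alpha>)+
  show ?thesis unfolding linear_in_degree_def using cone_linear_res by blast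
qed

section \<open>Cones over monomial ideals\<close>

lemma monomial_ideal_empty [simp]: "monomial_ideal n {} = {0}"
  by (auto simp: monomial_ideal_def)

lemma monomial_ideal_unit: "monomial_ideal n {0} = poly_ring n"
  by (auto simp: monomial_ideal_def)

lemma monomial_ideal_sum:
  assumes "\<And>i. i \<in> A \<Longrightarrow> f i \<in> monomial_ideal n M"
  shows "sum f A \<in> monomial_ideal n M"
proof -
  have "sum f A \<in> poly_ring n" using assms by (intro poly_ring_sum) (auto simp: monomial_ideal_def)
  moreover have "\<exists>g\<in>M. mdvd g m" if "m \<in> Poly_Mapping.keys (sum f A)" for m
  proof -
    have "(\<Sum>i\<in>A. Poly_Mapping.lookup (f i) m) \<noteq> 0" using that by (simp add: in_keys_iff lookup_sum)
    then obtain i where "i \<in> A" "Poly_Mapping.lookup (f i) m \<noteq> 0" by (meson sum.neutral)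
    then show ?thesis using assms[of i] by (auto simp: monomial_ideal_def in_keys_iff)
  qed
  ultimately show ?thesis by (simp add: monomial_ideal_def)
qed

lemma monomial_ideal_single:
  "Poly_Mapping.keys m \<subseteq> {1..n} \<Longrightarrow> g \<in> M \<Longrightarrow> mdvd g m \<Longrightarrow> Poly_Mapping.single m c \<in> monomial_ideal n M"
  by (auto simp: monomial_ideal_def poly_ring_def split: if_splits)

lemma keys_Var_mult: "Poly_Mapping.keys (Var i * g :: 'k::comm_ring_1 mpoly) \<subseteq> (\<lambda>k. Poly_Mapping.single i 1 + k) ` Poly_Mapping.keys g"
proof
  fix m assume "m \<in> Poly_Mapping.keys (Var i * g)"
  then obtain a k where "m = a + k" "a \<in> Poly_Mapping.keys (Var i :: 'k mpoly)" "k \<in> Poly_Mapping.keys g"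
    using keys_mult[of "Var i" g] by blast
  then show "m \<in> (\<lambda>k. Poly_Mapping.single i 1 + k) ` Poly_Mapping.keys g" by (simp add: Var_def)
qed

lemma lookup_Var_mult: "Poly_Mapping.lookup (Var i * g :: 'k::comm_ring_1 mpoly) (Poly_Mapping.single i 1 + k) = Poly_Mapping.lookup g k"
  by (simp add: Var_def lookup_single_times)

text \<open>The terms of an element that are divisible by a member of \<open>M\<close> are collected
  in \<open>f\<close>. Every other term is divisible by the variable times a member of
  \<open>M'\<close>, so the truncated difference \<open>m - ?x\<close> really cancels the
  variable.\<close>

lemma monomial_ideal_insert_multiples:
  assumes i: "i \<in> {1..n}"
  shows "monomial_ideal n (M \<union> (\<lambda>m. Poly_Mapping.single i 1 + m) ` M') =
    {f + Var i * g | f g. f \<in> monomial_ideal n M \<and> g \<in> (monomial_ideal n M' :: 'k::field mpoly set)}"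
    (is "?I = ?R")
proof (intro equalityI subsetI)
  fix F :: "'k mpoly" assume F: "F \<in> ?I"
  let ?x = "Poly_Mapping.single i 1 :: nat \<Rightarrow>\<^sub>0 nat"
  define A where "A = {m \<in> Poly_Mapping.keys F. \<exists>g\<in>M. mdvd g m}"
  define A' where "A' = Poly_Mapping.keys F - A"
  have ring: "Poly_Mapping.keys m \<subseteq> {1..n}" if "m \<in> Poly_Mapping.keys F" for m
    using F that by (auto simp: monomial_ideal_def poly_ring_def)
  define f where "f = (\<Sum>m\<in>A. Poly_Mapping.single m (Poly_Mapping.lookup F m))"
  define g where "g = (\<Sum>m\<in>A'. Poly_Mapping.single (m - ?x) (Poly_Mapping.lookup F m))"
  have A': "\<exists>m'\<in>M'. \<exists>k. m = ?x + (m' + k)" if "m \<in> A'" for m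
  proof -
    from that have "m \<in> Poly_Mapping.keys F" "\<not> (\<exists>g\<in>M. mdvd g m)" by (auto simp: A'_def A_def)
    moreover from this F have "\<exists>g \<in> M \<union> (\<lambda>m. ?x + m) ` M'. mdvd g m" unfolding monomial_ideal_def by blast
    ultimately show ?thesis by (fastforce simp: add.assoc)
  qed
  have "F = f + Var i * g"
  proof -
    have "F = (\<Sum>m\<in>A. Poly_Mapping.single m (Poly_Mapping.lookup F m)) + (\<Sum>m\<in>A'. Poly_Mapping.single m (Poly_Mapping.lookup F m))"
      by (subst sum.union_disjoint[symmetric], (auto simp: A_def A'_def)[3])
         (subst sum_single_lookup[symmetric], rule sum.cong, auto simp: A_def A'_def)
    also have "(\<Sum>m\<in>A'. Poly_Mapping.single m (Poly_Mapping.lookup F m)) = Var i * g"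
      unfolding g_def sum_distrib_left
    proof (rule sum.cong[OF refl])
      fix m assume "m \<in> A'"
      then obtain k where "m = ?x + k" using A' by blast
      then show "Poly_Mapping.single m (Poly_Mapping.lookup F m) = Var i * Poly_Mapping.single (m - ?x) (Poly_Mapping.lookup F m)"
        by (simp add: Var_def mult_single)
    qed
    finally show ?thesis by (simp add: f_def)
  qed
  moreover have "f \<in> monomial_ideal n M"
    unfolding f_def
  proof (rule monomial_ideal_sum)
    fix m assume "m \<in> A"
    then obtain g where "g \<in> M" "mdvd g m" "m \<in> Poly_Mapping.keys F" unfolding A_def by blast
    then show "Poly_Mapping.single m (Poly_Mapping.lookup F m) \<in> monomial_ideal n M"
      using ring by (intro monomial_ideal_single)
  qed
  moreover have "g \<in> monomial_ideal n M'"
    unfolding g_def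
  proof (rule monomial_ideal_sum)
    fix m assume m: "m \<in> A'"
    then obtain m' k where mk: "m' \<in> M'" "m = ?x + (m' + k)" using A' by blast
    have "Poly_Mapping.keys (m' + k) \<subseteq> Poly_Mapping.keys m" by (auto simp: mk in_keys_iff lookup_add)
    moreover have "Poly_Mapping.keys m \<subseteq> {1..n}" using ring m by (auto simp: A'_def)
    ultimately show "Poly_Mapping.single (m - ?x) (Poly_Mapping.lookup F m) \<in> monomial_ideal n M'"
      using mk by (intro monomial_ideal_single[of _ _ m']) auto
  qed
  ultimately show "F \<in> ?R" by blast
next
  fix F :: "'k mpoly" assume "F \<in> ?R"
  then obtain f g where F: "F = f + Var i * g" and f: "f \<in> monomial_ideal n M" and g: "g \<in> monomial_ideal n M'"
    by blast
  have "F \<in> poly_ring n" unfolding F using f g i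
    by (intro poly_ring_add poly_ring_mult poly_ring_Var) (auto simp: monomial_ideal_def)
  moreover have "\<exists>e\<in>M \<union> (\<lambda>m. Poly_Mapping.single i 1 + m) ` M'. mdvd e m" if m: "m \<in> Poly_Mapping.keys F" for m
  proof -
    from m consider "m \<in> Poly_Mapping.keys f" | k where "k \<in> Poly_Mapping.keys g" "m = Poly_Mapping.single i 1 + k"
      using keys_add[of f "Var i * g"] keys_Var_mult[of i g] unfolding F by blast
    then show ?thesis
    proof cases
      case 1
      then show ?thesis using f by (fastforce simp: monomial_ideal_def)
    next
      case 2
      then obtain e k' where "e \<in> M'" "k = e + k'" using g by (fastforce simp: monomial_ideal_def)
      with 2 show ?thesis
        by (intro bexI[of _ "Poly_Mapping.single i 1 + e"] exI[of _ k']) (auto simp: add.assoc)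
    qed
  qed
  ultimately show "F \<in> ?I" by (simp add: monomial_ideal_def)
qed

text \<open>The variable occurs in no generator from \<open>M\<close>, hence is regular modulo their
  ideal: if such a generator divides x_i m, the factor x_i lies in the cofactor \<open>k\<close> and
  can be removed there.\<close>

lemma linear_monomial_cone:
  assumes "linear_in_degree n (Suc d) (monomial_ideal n M :: 'k::field mpoly set)"
    and "linear_in_degree n d (monomial_ideal n M' :: 'k::field mpoly set)"
    and i: "i \<in> {1..n}" and M: "\<And>m. m \<in> M \<Longrightarrow> i \<notin> Poly_Mapping.keys m"
    and sub: "\<And>m. m \<in> M \<Longrightarrow> \<exists>m'\<in>M'. mdvd m' m"
  shows "linear_in_degree n (Suc d) (monomial_ideal n (M \<union> (\<lambda>m. Poly_Mapping.single i 1 + m) ` M') :: 'k mpoly set)"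
  unfolding monomial_ideal_insert_multiples[OF i]
proof (rule linear_in_degree_cone[OF assms(1,2)])
  show "monomial_ideal n M \<subseteq> (monomial_ideal n M' :: 'k mpoly set)"
  proof
    fix f :: "'k mpoly" assume f: "f \<in> monomial_ideal n M"
    have "\<exists>g\<in>M'. mdvd g m" if m: "m \<in> Poly_Mapping.keys f" for m
    proof -
      obtain g k where g: "g \<in> M" "m = g + k" using f m by (fastforce simp: monomial_ideal_def)
      then obtain g' k' where "g' \<in> M'" "g = g' + k'" using sub by blast
      then show ?thesis using g by (intro bexI[of _ g'] exI[of _ "k' + k"]) (auto simp: add.assoc)
    qed
    then show "f \<in> monomial_ideal n M'" using f by (simp add: monomial_ideal_def)
  qed
  show "Var i \<noteq> (0 :: 'k mpoly)" by (simp add: Var_def flip: keys_eq_empty)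
  show "Var i \<in> (poly_ring n :: 'k mpoly set)" using i by (rule poly_ring_Var)
  show "homogeneous 1 (Var i :: 'k mpoly)" by (rule homogeneous_Var)
next
  fix f :: "'k mpoly" assume f: "f \<in> poly_ring n" "Var i * f \<in> monomial_ideal n M"
  have "\<exists>g\<in>M. mdvd g m" if m: "m \<in> Poly_Mapping.keys f" for m
  proof -
    let ?x = "Poly_Mapping.single i 1 :: nat \<Rightarrow>\<^sub>0 nat"
    have "?x + m \<in> Poly_Mapping.keys (Var i * f)"
      using m lookup_Var_mult[of i f m] by (simp add: in_keys_iff)
    then obtain g k where g: "g \<in> M" "?x + m = g + k" using f(2) by (fastforce simp: monomial_ideal_def)
    have "i \<notin> Poly_Mapping.keys g" using M g(1) by blast
    then have gi: "Poly_Mapping.lookup g i = 0" by (simp add: in_keys_iff)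
    have lk: "Poly_Mapping.lookup ?x j + Poly_Mapping.lookup m j = Poly_Mapping.lookup g j + Poly_Mapping.lookup k j" for j
      using arg_cong[OF g(2), of "\<lambda>p. Poly_Mapping.lookup p j"] by (simp only: lookup_add)
    have "m = g + (k - ?x)"
    proof (rule poly_mapping_eqI)
      fix j show "Poly_Mapping.lookup m j = Poly_Mapping.lookup (g + (k - ?x)) j"
        using lk[of j] gi by (cases "j = i") (auto simp: lookup_add lookup_minus lookup_single)
    qed
    then show ?thesis using g(1) by blast
  qed
  then show "f \<in> monomial_ideal n M" using f(1) by (simp add: monomial_ideal_def)
qed

lemma linear_variables:
  assumes "U \<subseteq> {1..n}"
  shows "linear_in_degree n 1 (monomial_ideal n ((\<lambda>u. Poly_Mapping.single u 1) ` U) :: 'k::field mpoly set)"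
proof -
  have "finite U" using assms finite_subset by blast
  then show ?thesis using assms
  proof (induction U)
    case empty
    then show ?case by (simp add: linear_in_degree_zero)
  next
    case (insert u U)
    have "linear_in_degree n (Suc 0) (monomial_ideal n ((\<lambda>u. Poly_Mapping.single u 1) ` U \<union>
        (\<lambda>m. Poly_Mapping.single u 1 + m) ` {0}) :: 'k mpoly set)"
      using insert by (intro linear_monomial_cone) (auto simp: monomial_ideal_unit linear_in_degree_unit)
    then show ?case by simp
  qed
qed

text \<open>The vertex \<open>v\<close> is simplicial in the complement of the graph induced on \<open>W\<close>.\<close>

definition elimination_order :: "nat \<Rightarrow> nat set set \<Rightarrow> bool" where
  "elimination_order n G \<longleftrightarrow> (\<forall>W\<subseteq>{1..n}. W \<noteq> {} \<longrightarrow>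
     (\<exists>v\<in>W. \<forall>a\<in>W - {v}. \<forall>b\<in>W - {v}. {a, b} \<in> G \<longrightarrow> {v, a} \<in> G \<or> {v, b} \<in> G))"

text \<open>Induction on the size of \<open>W\<close>: the generators split into the edges inside
  \<open>W - {v}\<close> and the multiples x_v x_u with \<open>u\<close> in the neighbourhood
  \<open>N\<close>. The choice of \<open>v\<close> is what makes every edge monomial of the first
  kind divisible by a variable from \<open>N\<close>.\<close>

lemma linear_edge_ideal:
  assumes G: "G \<subseteq> vertex_pairs n" and elim: "elimination_order n G" and W: "W \<subseteq> {1..n}"
  shows "linear_in_degree n 2 (monomial_ideal n
     {Poly_Mapping.single i 1 + Poly_Mapping.single j 1 | i j. i \<in> W \<and> j \<in> W \<and> {i, j} \<in> G} :: 'k::field mpoly set)"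
  using W
proof (induction "card W" arbitrary: W)
  case 0
  then have "W = {}" using finite_subset[OF 0(2)] by simp
  then show ?case by (simp add: linear_in_degree_zero)
next
  case (Suc c)
  then have "W \<noteq> {}" by auto
  then obtain v where v: "v \<in> W"
    "\<And>a b. a \<in> W - {v} \<Longrightarrow> b \<in> W - {v} \<Longrightarrow> {a, b} \<in> G \<Longrightarrow> {v, a} \<in> G \<or> {v, b} \<in> G"
    using elim[unfolded elimination_order_def, rule_format, OF Suc.prems] by blast
  define N where "N = {u \<in> W. {v, u} \<in> G}"
  let ?E = "\<lambda>W. {Poly_Mapping.single i 1 + Poly_Mapping.single j 1 | i j. i \<in> W \<and> j \<in> W \<and> {i, j} \<in> G} :: (nat \<Rightarrow>\<^sub>0 nat) set"
  have E: "?E W = ?E (W - {v}) \<union> (\<lambda>m. Poly_Mapping.single v 1 + m) ` (\<lambda>u. Poly_Mapping.single u 1) ` N"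
  proof (intro equalityI subsetI)
    fix m assume "m \<in> ?E W"
    then obtain i j where ij: "m = Poly_Mapping.single i 1 + Poly_Mapping.single j 1" "i \<in> W" "j \<in> W" "{i, j} \<in> G" by blast
    consider "i = v" | "j = v" | "i \<noteq> v" "j \<noteq> v" by blast
    then show "m \<in> ?E (W - {v}) \<union> (\<lambda>m. Poly_Mapping.single v 1 + m) ` (\<lambda>u. Poly_Mapping.single u 1) ` N"
    proof cases
      case 2
      then have "i \<in> N" "m = Poly_Mapping.single v 1 + Poly_Mapping.single i 1"
        using ij by (auto simp: N_def insert_commute add.commute)
      then show ?thesis by blast
    qed (use ij in \<open>auto simp: N_def\<close>)
  next
    fix m assume "m \<in> ?E (W - {v}) \<union> (\<lambda>m. Poly_Mapping.single v 1 + m) ` (\<lambda>u. Poly_Mapping.single u 1) ` N"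
    then show "m \<in> ?E W" using v(1) unfolding N_def by blast
  qed
  have Nsub: "N \<subseteq> {1..n}" using Suc.prems by (auto simp: N_def)
  have "card (W - {v}) = c" using Suc.hyps(2) v(1) by simp
  then have IH: "linear_in_degree n (Suc 1) (monomial_ideal n (?E (W - {v})) :: 'k mpoly set)"
    using Suc.hyps(1)[of "W - {v}"] Suc.prems by (simp add: numeral_2_eq_2 subset_iff)
  have "linear_in_degree n (Suc 1) (monomial_ideal n (?E W) :: 'k mpoly set)"
    unfolding E
  proof (rule linear_monomial_cone[OF IH linear_variables[OF Nsub]])
    show "v \<in> {1..n}" using v(1) Suc.prems by blast
    show "v \<notin> Poly_Mapping.keys m" if "m \<in> ?E (W - {v})" for m
      using that keys_add by (fastforce split: if_splits)
    show "\<exists>m'\<in>(\<lambda>u. Poly_Mapping.single u 1) ` N. mdvd m' m" if "m \<in> ?E (W - {v})" for m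
    proof -
      from that obtain i j where ij: "m = Poly_Mapping.single i 1 + Poly_Mapping.single j 1"
        "i \<in> W - {v}" "j \<in> W - {v}" "{i, j} \<in> G" by blast
      then have "i \<in> N \<or> j \<in> N" using v(2) by (auto simp: N_def)
      then show ?thesis
      proof
        assume "j \<in> N"
        then show ?thesis using ij(1) by (metis add.commute imageI)
      qed (use ij(1) in blast)
    qed
  qed
  then show ?case by (simp add: numeral_2_eq_2)
qed

lemma elimination_order_has_linear_resolution:
  assumes G: "G \<subseteq> vertex_pairs n" and elim: "elimination_order n G"
  shows "has_linear_resolution n (edge_ideal (K :: 'k::field itself) n G)"
proof -
  have *: "i \<in> {1..n} \<and> j \<in> {1..n}" if "{i, j} \<in> G" for i j
    using that G by (fastforce simp: vertex_pairs_def doubleton_eq_iff)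
  have "{Poly_Mapping.single i 1 + Poly_Mapping.single j 1 | i j. i \<in> {1..n} \<and> j \<in> {1..n} \<and> {i, j} \<in> G} =
    ({Poly_Mapping.single i 1 + Poly_Mapping.single j 1 | i j. {i, j} \<in> G} :: (nat \<Rightarrow>\<^sub>0 nat) set)"
    using * by blast
  then have "linear_in_degree n 2 (edge_ideal K n G)"
    using linear_edge_ideal[OF G elim subset_refl] by (simp only: edge_ideal_monomial[OF G])
  then show ?thesis unfolding linear_in_degree_def using linear_res.has_linear_resolution by blast
qed

lemma has_linear_resolution_imp_presentation:
  "has_linear_resolution n I \<Longrightarrow> has_linear_presentation n I"
  unfolding has_linear_resolution_def has_linear_presentation_def One_nat_def by blast

section \<open>Obstruction to a linear presentation\<close>

text \<open>Reads off a coefficient from an explicit list of factorizations of the monomial; listed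
  pairs outside the supports contribute zero.\<close>

lemma lookup_times_pairs:
  fixes f g :: "'a::comm_monoid_add \<Rightarrow>\<^sub>0 'k::comm_ring_1"
  assumes "finite P" and P: "\<And>a b. (a, b) \<in> P \<Longrightarrow> a + b = m"
    and cover: "\<And>a b. a \<in> Poly_Mapping.keys f \<Longrightarrow> b \<in> Poly_Mapping.keys g \<Longrightarrow> a + b = m \<Longrightarrow> (a, b) \<in> P"
  shows "Poly_Mapping.lookup (f * g) m = (\<Sum>(a, b)\<in>P. Poly_Mapping.lookup f a * Poly_Mapping.lookup g b)"
proof -
  let ?K = "Poly_Mapping.keys f \<times> Poly_Mapping.keys g"
  have "Poly_Mapping.lookup (f * g) m =
     (\<Sum>(a, b)\<in>?K. if a + b = m then Poly_Mapping.lookup f a * Poly_Mapping.lookup g b else 0)"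
    unfolding lookup_times_keys by (rule sum.cartesian_product)
  also have "\<dots> = (\<Sum>(a, b)\<in>?K \<inter> P. Poly_Mapping.lookup f a * Poly_Mapping.lookup g b)"
    using P cover by (intro sum.mono_neutral_cong_right) (auto split: if_splits)
  also have "\<dots> = (\<Sum>(a, b)\<in>P. Poly_Mapping.lookup f a * Poly_Mapping.lookup g b)"
    using \<open>finite P\<close> by (intro sum.mono_neutral_left) (auto simp: in_keys_iff)
  finally show ?thesis .
qed

lemma lookup_linear_times:
  fixes f g :: "'k::comm_ring_1 mpoly"
  assumes "homogeneous 1 f" "c \<noteq> d"
  shows "Poly_Mapping.lookup (f * g) (Poly_Mapping.single c 1 + Poly_Mapping.single d 1) =
    Poly_Mapping.lookup f (Poly_Mapping.single c 1) * Poly_Mapping.lookup g (Poly_Mapping.single d 1) +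
    Poly_Mapping.lookup f (Poly_Mapping.single d 1) * Poly_Mapping.lookup g (Poly_Mapping.single c 1)"
proof -
  let ?s = "\<lambda>i. Poly_Mapping.single i 1 :: nat \<Rightarrow>\<^sub>0 nat"
  have ne: "?s c \<noteq> ?s d" using assms(2) by (metis keys_single singleton_inject zero_neq_one)
  have "Poly_Mapping.lookup (f * g) (?s c + ?s d) =
     (\<Sum>(a, b)\<in>{(?s c, ?s d), (?s d, ?s c)}. Poly_Mapping.lookup f a * Poly_Mapping.lookup g b)"
  proof (rule lookup_times_pairs)
    show "(a, b) \<in> {(?s c, ?s d), (?s d, ?s c)}"
      if "a \<in> Poly_Mapping.keys f" "b \<in> Poly_Mapping.keys g" and ab: "a + b = ?s c + ?s d" for a b
    proof -
      have "total_degree a = 1" using that assms(1) by (auto simp: homogeneous_def)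
      then obtain i where i: "a = ?s i" by (rule total_degree_1E)
      have "Poly_Mapping.lookup (?s c + ?s d) i \<ge> 1"
        unfolding ab[symmetric] i by (simp add: lookup_add)
      then have "i = c \<or> i = d" by (auto simp: lookup_add lookup_single when_def split: if_splits)
      then show ?thesis
      proof
        assume "i = c"
        then have "?s c + b = ?s c + ?s d" using ab i by simp
        then show ?thesis using i \<open>i = c\<close> by simp
      next
        assume "i = d"
        then have "?s d + b = ?s d + ?s c" using ab i by (simp add: add.commute)
        then show ?thesis using i \<open>i = d\<close> by simp
      qed
    qed
  qed (auto simp: add.commute)
  then show ?thesis using ne by simp
qed

text \<open>The distinct endpoints \<open>i\<close> and \<open>j\<close> are among \<open>a\<close>,
  \<open>b\<close>, \<open>c\<close>, and no edge joins \<open>c\<close> to \<open>a\<close> or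
  \<open>b\<close>; only the pair of \<open>a\<close> and \<open>b\<close> remains.\<close>

lemma edge_monomial_dvd:
  assumes "{i, j} \<in> G" "i \<noteq> j" and gap: "{a, c} \<notin> G" "{b, c} \<notin> G"
    and "Poly_Mapping.single i 1 + Poly_Mapping.single j 1 + k =
      Poly_Mapping.single a 1 + Poly_Mapping.single b 1 + (Poly_Mapping.single c (Suc 0) :: nat \<Rightarrow>\<^sub>0 nat)"
  shows "Poly_Mapping.single i 1 + Poly_Mapping.single j 1 =
      (Poly_Mapping.single a 1 + Poly_Mapping.single b 1 :: nat \<Rightarrow>\<^sub>0 nat)"
proof -
  have *: "Poly_Mapping.lookup (Poly_Mapping.single i 1 + Poly_Mapping.single j 1 + k) l =
      Poly_Mapping.lookup (Poly_Mapping.single a 1 + Poly_Mapping.single b 1 + (Poly_Mapping.single c (Suc 0))) l" for l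
    using assms(5) by simp
  have "i \<in> {a, b, c}" "j \<in> {a, b, c}"
    using *[of i] *[of j] by (auto simp: lookup_add lookup_single when_def split: if_splits)
  then show ?thesis using assms(1-4) by (auto simp: add.commute insert_commute)
qed

text \<open>The generators in the given resolution are arbitrary elements of the ideal, so a
  component at x_a x_b need not exist. It is replaced by weighting component r with the coefficient
  of x_a x_b in the r-th generator. At x_c x_d the weighted sum is 1 for the Koszul syzygy, but 0
  for everything generated by linear syzygies.\<close>

lemma linear_presentation_no_gap:
  assumes G: "G \<subseteq> vertex_pairs n"
    and pres: "has_linear_presentation n (edge_ideal (K :: 'k::field itself) n G)"
    and ab: "{a, b} \<in> G" and cd: "{c, d} \<in> G" and "c \<noteq> d"
    and cross: "{a, c} \<notin> G" "{b, c} \<notin> G" "{a, d} \<notin> G" "{b, d} \<notin> G"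
  shows False
proof -
  let ?s = "\<lambda>i. Poly_Mapping.single i 1 :: nat \<Rightarrow>\<^sub>0 nat"
  let ?I = "edge_ideal K n G"
  let ?L = "Poly_Mapping.lookup :: 'k mpoly \<Rightarrow> _"
  define E where "E = {?s i + ?s j | i j. {i, j} \<in> G}"
  have I: "?I = monomial_ideal n E" unfolding E_def by (rule edge_ideal_monomial[OF G])
  have G_range: "i \<in> {1..n}" "j \<in> {1..n}" "i \<noteq> j" if "{i, j} \<in> G" for i j
    using that G by (fastforce simp: vertex_pairs_def doubleton_eq_iff)+
  obtain \<Phi> \<delta> where res: "minimal_graded_free_resolution n ?I \<Phi> \<delta>"
    and lin: "\<forall>f \<in> elements_mat (\<Phi> 1). homogeneous 1 f"
    using pres unfolding has_linear_presentation_def by blast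
  then have gr: "graded_free_resolution n ?I \<Phi> \<delta>" unfolding minimal_graded_free_resolution_def by blast
  define N where "N = dim_col (\<Phi> 0)"
  define M where "M = dim_col (\<Phi> 1)"
  note gr' = gr[unfolded graded_free_resolution_def]
  have "\<forall>i. dim_row (\<Phi> (Suc i)) = dim_col (\<Phi> i)" using gr' by (elim conjE)
  moreover have "dim_row (\<Phi> 0) = 1" using gr' by (elim conjE)
  ultimately have dims: "dim_row (\<Phi> 0) = 1" "dim_row (\<Phi> 1) = N" "dim_col (\<Phi> 0) = N" "dim_col (\<Phi> 1) = M"
    by (simp_all add: N_def M_def)
  have image: "(\<lambda>v. (\<Phi> 0 *\<^sub>v v) $ 0) ` free_module n N = ?I"
    using gr' unfolding N_def by (elim conjE)
  have "\<forall>i. {v \<in> free_module n (dim_col (\<Phi> i)). \<Phi> i *\<^sub>v v = 0\<^sub>v (dim_row (\<Phi> i))} =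
          (\<lambda>v. \<Phi> (Suc i) *\<^sub>v v) ` free_module n (dim_col (\<Phi> (Suc i)))"
    using gr' by (elim conjE)
  from this[rule_format, of 0]
  have exact: "{v \<in> free_module n N. \<Phi> 0 *\<^sub>v v = 0\<^sub>v 1} = (\<lambda>v. \<Phi> 1 *\<^sub>v v) ` free_module n M"
    by (simp only: dims One_nat_def[symmetric])
  define p where "p r = \<Phi> 0 $$ (0, r)" for r
  define l where "l r k = \<Phi> 1 $$ (r, k)" for r k
  have \<Phi>0: "(\<Phi> 0 *\<^sub>v v) $ 0 = (\<Sum>r<N. p r * v $ r)" if "v \<in> carrier_vec N" for v
    using that dims by (simp add: scalar_prod_def p_def atLeast0LessThan)
  have \<Phi>1: "(\<Phi> 1 *\<^sub>v v) $ r = (\<Sum>k<M. l r k * v $ k)" if "v \<in> carrier_vec M" "r < N" for v r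
    using that dims by (simp add: scalar_prod_def l_def atLeast0LessThan)
  have unit_free: "unit_vec m i \<in> free_module n m" for m i
    by (auto simp: free_module_def unit_vec_def)
  have p_in: "p r \<in> monomial_ideal n E" if "r < N" for r
  proof -
    have "(\<Phi> 0 *\<^sub>v unit_vec N r) $ 0 = p r"
      using that by (subst \<Phi>0) (auto simp: unit_vec_def if_distrib[of "\<lambda>y. _ * y"] sum.delta cong: if_cong)
    then have "p r \<in> (\<lambda>v. (\<Phi> 0 *\<^sub>v v) $ 0) ` free_module n N"
      by (intro image_eqI[OF _ unit_free[of N r]]) simp
    then show ?thesis by (simp only: image I)
  qed
  have l_hom: "homogeneous 1 (l r k)" if "r < N" "k < M" for r k
    using lin that dims elements_matI[of "\<Phi> 1" N M r k] unfolding l_def by (metis carrier_matI)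
  have column: "(\<Sum>r<N. p r * l r k) = 0" if k: "k < M" for k
  proof -
    let ?v = "\<Phi> 1 *\<^sub>v unit_vec M k"
    have v: "?v \<in> free_module n N" "\<Phi> 0 *\<^sub>v ?v = 0\<^sub>v 1"
      using imageI[OF unit_free[of M k], of "\<lambda>v. \<Phi> 1 *\<^sub>v v"] unfolding exact[symmetric] by simp_all
    have "?v $ r = l r k" if "r < N" for r
      using that k by (subst \<Phi>1) (auto simp: unit_vec_def if_distrib[of "\<lambda>y. _ * y"] sum.delta cong: if_cong)
    then have "(\<Sum>r<N. p r * l r k) = (\<Sum>r<N. p r * ?v $ r)" by simp
    also have "\<dots> = (\<Phi> 0 *\<^sub>v ?v) $ 0" using v(1) by (subst \<Phi>0) (auto simp: free_module_def)
    finally show ?thesis unfolding v(2) by simp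
  qed
  \<comment> \<open>If $e$ is $c$ or $d$, then \<open>I\<close> has no monomial of degree two dividing $x_a x_b x_e$ apart from $x_a x_b$.
    Hence the functional given by \<open>\<kappa>\<close> annihilates the coefficients of $x_c$ and $x_d$ in linear syzygies.\<close>
  define \<kappa> where "\<kappa> r = ?L (p r) (?s a + ?s b)" for r

  have coeff_linear: "?L (p r * f) (?s a + ?s b + ?s e) = \<kappa> r * ?L f (?s e)"
    if r: "r < N" and f: "homogeneous 1 f" and e: "{a, e} \<notin> G" "{b, e} \<notin> G" for r f e
  proof -
    have "?L (p r * f) (?s a + ?s b + ?s e) = (\<Sum>(m, m')\<in>{(?s a + ?s b, ?s e)}. ?L (p r) m * ?L f m')"
    proof (rule lookup_times_pairs)
      fix m m' assume m: "m \<in> Poly_Mapping.keys (p r)" "m' \<in> Poly_Mapping.keys f" "m + m' = ?s a + ?s b + ?s e"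
      from m(1) p_in[OF r] obtain i j k where ij: "{i, j} \<in> G" "m = ?s i + ?s j + k"
        unfolding monomial_ideal_def E_def by blast
      have "total_degree m' = 1" using m(2) f by (auto simp: homogeneous_def)
      moreover have "total_degree (m + m') = 3" unfolding m(3) by (simp add: total_degree_add)
      ultimately have "total_degree k = 0" unfolding ij(2) by (simp add: total_degree_add)
      then have "k = 0" by (auto simp: total_degree_def in_keys_iff intro!: poly_mapping_eqI)
      have "?s i + ?s j = ?s a + ?s b"
        using edge_monomial_dvd[OF ij(1) G_range(3)[OF ij(1)] e, of m'] m(3) ij(2) \<open>k = 0\<close> by simp
      then show "(m, m') \<in> {(?s a + ?s b, ?s e)}" using m(3) ij(2) \<open>k = 0\<close> by simp
    qed auto
    then show ?thesis by (simp add: \<kappa>_def)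
  qed
  have coeff_const: "?L (p r * f) (?s a + ?s b) = \<kappa> r * ?L f 0" if r: "r < N" for r f
  proof -
    have "?L (p r * f) (?s a + ?s b) = (\<Sum>(m, m')\<in>{(?s a + ?s b, 0)}. ?L (p r) m * ?L f m')"
    proof (rule lookup_times_pairs)
      fix m m' assume m: "m \<in> Poly_Mapping.keys (p r)" "m' \<in> Poly_Mapping.keys f" "m + m' = ?s a + ?s b"
      from m(1) p_in[OF r] obtain i j k where ij: "{i, j} \<in> G" "m = ?s i + ?s j + k"
        unfolding monomial_ideal_def E_def by blast
      have "total_degree (m + m') = 2" unfolding m(3) by (simp add: total_degree_add)
      then have "total_degree m' = 0" unfolding ij(2) by (simp add: total_degree_add)
      then have "m' = 0" by (auto simp: total_degree_def in_keys_iff intro!: poly_mapping_eqI)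
      then show "(m, m') \<in> {(?s a + ?s b, 0)}" using m(3) by simp
    qed auto
    then show ?thesis by (simp add: \<kappa>_def)
  qed
  have \<kappa>_column: "(\<Sum>r<N. \<kappa> r * ?L (l r k) (?s e)) = 0" if k: "k < M" and e: "{a, e} \<notin> G" "{b, e} \<notin> G" for k e
  proof -
    have "(\<Sum>r<N. \<kappa> r * ?L (l r k) (?s e)) = ?L (\<Sum>r<N. p r * l r k) (?s a + ?s b + ?s e)"
      unfolding lookup_sum using coeff_linear l_hom k e by (intro sum.cong) auto
    then show ?thesis using column[OF k] by simp
  qed

  have edge_in: "\<exists>u\<in>free_module n N. (\<Sum>r<N. p r * u $ r) = Var i * Var j" if "{i, j} \<in> G" for i j
  proof -
    have "Var i * Var j = 1 * (Var i * Var j :: 'k mpoly)" by simp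
    also have "\<dots> \<in> ?I"
      unfolding edge_ideal_def using that by (intro ideal_generated_multiple) auto
    finally obtain u where "u \<in> free_module n N" "(\<Phi> 0 *\<^sub>v u) $ 0 = Var i * Var j" unfolding image[symmetric] by auto
    then show ?thesis using \<Phi>0[of u] by (intro bexI[of _ u]) (auto simp: free_module_def)
  qed
  from edge_in[OF ab] obtain u where u: "u \<in> free_module n N" "(\<Sum>r<N. p r * u $ r) = Var a * Var b" by blast
  from edge_in[OF cd] obtain w where w: "w \<in> free_module n N" "(\<Sum>r<N. p r * w $ r) = Var c * Var d" by blast
  \<comment> \<open>The Koszul syzygy of the two edge monomials, written through expressions
    \<open>u\<close> and \<open>w\<close> of these monomials in the given generators.\<close>
  define t where "t = vec N (\<lambda>r. Var c * Var d * u $ r - Var a * Var b * w $ r)"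
  have t: "t \<in> free_module n N"
    using u(1) w(1) G_range(1,2)[OF ab] G_range(1,2)[OF cd]
    by (auto simp: t_def free_module_def intro!: poly_ring_diff poly_ring_mult poly_ring_Var)
  have "(\<Phi> 0 *\<^sub>v t) $ 0 = (\<Sum>r<N. Var c * Var d * (p r * u $ r) - Var a * Var b * (p r * w $ r))"
    using t by (subst \<Phi>0) (auto simp: free_module_def t_def algebra_simps)
  also have "\<dots> = Var c * Var d * (Var a * Var b) - Var a * Var b * (Var c * Var d)"
    by (simp only: sum_subtractf sum_distrib_left[symmetric] u(2) w(2))
  finally have "\<Phi> 0 *\<^sub>v t = 0\<^sub>v 1" using dims by (intro eq_vecI) auto
  with t have "t \<in> (\<lambda>v. \<Phi> 1 *\<^sub>v v) ` free_module n M" unfolding exact[symmetric] by simp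
  then obtain v where v: "v \<in> free_module n M" "t = \<Phi> 1 *\<^sub>v v" by blast

  have "(\<Sum>r<N. \<kappa> r * ?L (t $ r) (?s c + ?s d)) =
      (\<Sum>r<N. \<Sum>k<M. \<kappa> r * ?L (l r k) (?s c) * ?L (v $ k) (?s d) + \<kappa> r * ?L (l r k) (?s d) * ?L (v $ k) (?s c))"
  proof (rule sum.cong[OF refl])
    fix r assume "r \<in> {..<N}"
    then have r: "r < N" by simp
    have "?L (t $ r) (?s c + ?s d) = (\<Sum>k<M. ?L (l r k * v $ k) (?s c + ?s d))"
      unfolding v(2) using v(1) r by (subst \<Phi>1) (auto simp: free_module_def lookup_sum)
    also have "\<dots> = (\<Sum>k<M. ?L (l r k) (?s c) * ?L (v $ k) (?s d) + ?L (l r k) (?s d) * ?L (v $ k) (?s c))"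
      using l_hom r \<open>c \<noteq> d\<close> by (intro sum.cong refl lookup_linear_times) auto
    finally show "\<kappa> r * ?L (t $ r) (?s c + ?s d) =
       (\<Sum>k<M. \<kappa> r * ?L (l r k) (?s c) * ?L (v $ k) (?s d) + \<kappa> r * ?L (l r k) (?s d) * ?L (v $ k) (?s c))"
      by (simp add: sum_distrib_left algebra_simps)
  qed
  \<comment> \<open>In each product the linear factor supplies either x_c or x_d. After swapping the
    sums, the inner sum over \<open>r\<close> is the one that \<open>\<kappa>_column\<close>
    annihilates, for \<open>e = c\<close> and for \<open>e = d\<close>.\<close>
  also have "\<dots> = (\<Sum>k<M. (\<Sum>r<N. \<kappa> r * ?L (l r k) (?s c)) * ?L (v $ k) (?s d)
       + (\<Sum>r<N. \<kappa> r * ?L (l r k) (?s d)) * ?L (v $ k) (?s c))"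
    by (subst sum.swap) (simp add: sum.distrib sum_distrib_right)
  also have "\<dots> = 0"
    using \<kappa>_column[of _ c] \<kappa>_column[of _ d] cross by simp
  finally have zero: "(\<Sum>r<N. \<kappa> r * ?L (t $ r) (?s c + ?s d)) = 0" .

  \<comment> \<open>The part of \<open>t\<close> containing \<open>w\<close> drops out because x_a
    x_b does not divide x_c x_d. The constant terms of \<open>u\<close> remain, and these alone
    determine the coefficient of x_a x_b in the combination, as the ideal has no terms of degree
    below two.\<close>
  have "(\<Sum>r<N. \<kappa> r * ?L (t $ r) (?s c + ?s d)) = (\<Sum>r<N. \<kappa> r * ?L (u $ r) 0)"
  proof (rule sum.cong[OF refl])
    fix r assume "r \<in> {..<N}"
    then have "t $ r = Poly_Mapping.single (?s c + ?s d) 1 * u $ r - Poly_Mapping.single (?s a + ?s b) 1 * w $ r"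
      by (simp add: t_def Var_mult_Var)
    moreover have "?L (Poly_Mapping.single (?s c + ?s d) 1 * u $ r) (?s c + ?s d) = ?L (u $ r) 0"
      using lookup_single_times[of "?s c + ?s d" 1 "u $ r" 0] by simp
    moreover have "?L (Poly_Mapping.single (?s a + ?s b) 1 * w $ r) (?s c + ?s d) = 0"
    proof (rule lookup_single_times_not_mdvd, rule notI)
      assume "mdvd (?s a + ?s b) (?s c + ?s d)"
      then obtain k where "?s c + ?s d = ?s a + ?s b + k" by blast
      then have "Poly_Mapping.lookup (?s c + ?s d) a = Poly_Mapping.lookup (?s a + ?s b + k) a"
        by simp
      then have "a = c \<or> a = d" by (auto simp: lookup_add lookup_single when_def split: if_splits)
      then show False using cross cd ab by (auto simp: insert_commute)
    qed
    ultimately show "\<kappa> r * ?L (t $ r) (?s c + ?s d) = \<kappa> r * ?L (u $ r) 0"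
      by (simp add: lookup_minus)
  qed
  also have "\<dots> = ?L (\<Sum>r<N. p r * u $ r) (?s a + ?s b)"
    unfolding lookup_sum using coeff_const by (intro sum.cong) auto
  also have "\<dots> = 1" unfolding u(2) Var_mult_Var by simp
  finally show False using zero by simp
qed

section \<open>Probabilities of forbidden patterns\<close>

lemma vertex_pairs_subset: "vertex_pairs n \<subseteq> (\<lambda>(i, j). {i, j}) ` ({1..n} \<times> {1..n})"
  by (auto simp: vertex_pairs_def)

lemma finite_vertex_pairs [simp]: "finite (vertex_pairs n)"
  by (rule finite_subset[OF vertex_pairs_subset]) auto

lemma vertex_pairs_doubleton: "{i, j} \<in> vertex_pairs n \<longleftrightarrow> i \<in> {1..n} \<and> j \<in> {1..n} \<and> i \<noteq> j"
  by (fastforce simp: vertex_pairs_def doubleton_eq_iff)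

lemma set_pmf_random_graph: "set_pmf (random_graph n p) \<subseteq> Pow (vertex_pairs n)"
  by (auto simp: random_graph_def)

lemma prob_random_graph_mono:
  assumes "\<And>G. G \<subseteq> vertex_pairs n \<Longrightarrow> P G \<Longrightarrow> Q G"
  shows "measure_pmf.prob (random_graph n p) {G. P G} \<le> measure_pmf.prob (random_graph n p) {G. Q G}"
proof (rule measure_pmf.finite_measure_mono_AE)
  show "AE G in measure_pmf (random_graph n p). G \<in> {G. P G} \<longrightarrow> G \<in> {G. Q G}"
    using assms set_pmf_random_graph[of n p] by (auto simp: AE_measure_pmf_iff)
qed auto

lemma prob_random_graph_pattern:
  assumes p: "0 \<le> p" "p \<le> 1" and S: "S \<subseteq> vertex_pairs n" and T: "T \<subseteq> vertex_pairs n" and "S \<inter> T = {}"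
  shows "measure_pmf.prob (random_graph n p) {G. S \<subseteq> G \<and> T \<inter> G = {}} = p ^ card S * (1 - p) ^ card T"
proof -
  let ?V = "vertex_pairs n"
  let ?X = "\<lambda>e. if e \<in> S then {True} else if e \<in> T then {False} else UNIV"
  have "(\<lambda>f. {e \<in> ?V. f e}) -` {G. S \<subseteq> G \<and> T \<inter> G = {}} = Pi ?V ?X"
    using assms(3-5) by (auto simp: Pi_def subset_iff split: if_splits)
  then have "measure_pmf.prob (random_graph n p) {G. S \<subseteq> G \<and> T \<inter> G = {}} =
      (\<Prod>e\<in>?V. measure_pmf.prob (bernoulli_pmf p) (?X e))"
    unfolding random_graph_def measure_map_pmf by (simp add: measure_Pi_pmf_Pi)
  also have "\<dots> = (\<Prod>e\<in>?V. (if e \<in> S then p else 1) * (if e \<in> T then 1 - p else 1))"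
    using p \<open>S \<inter> T = {}\<close> by (intro prod.cong refl) (auto simp: measure_pmf_single)
  also have "\<dots> = (\<Prod>e\<in>?V \<inter> S. p) * (\<Prod>e\<in>?V \<inter> T. 1 - p)"
    by (simp only: prod.distrib prod.inter_restrict finite_vertex_pairs)
  also have "\<dots> = p ^ card S * (1 - p) ^ card T" using S T by (simp add: Int_absorb1)
  finally show ?thesis .
qed

lemma prob_random_graph_union_bound:
  assumes p: "0 \<le> p" "p \<le> 1" and "finite A"
    and pat: "\<And>x. x \<in> A \<Longrightarrow> S x \<subseteq> vertex_pairs n \<and> T x \<subseteq> vertex_pairs n \<and> S x \<inter> T x = {} \<and>
      card (S x) = s \<and> card (T x) = t"
    and cover: "\<And>G. G \<subseteq> vertex_pairs n \<Longrightarrow> P G \<Longrightarrow> \<exists>x\<in>A. S x \<subseteq> G \<and> T x \<inter> G = {}"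
  shows "measure_pmf.prob (random_graph n p) {G. P G} \<le> real (card A) * (p ^ s * (1 - p) ^ t)"
proof -
  have "measure_pmf.prob (random_graph n p) {G. P G} \<le>
      measure_pmf.prob (random_graph n p) {G. \<exists>x\<in>A. S x \<subseteq> G \<and> T x \<inter> G = {}}"
    by (rule prob_random_graph_mono) (rule cover)
  also have "{G. \<exists>x\<in>A. S x \<subseteq> G \<and> T x \<inter> G = {}} = (\<Union>x\<in>A. {G. S x \<subseteq> G \<and> T x \<inter> G = {}})"
    by blast
  also have "measure_pmf.prob (random_graph n p) \<dots> \<le>
      (\<Sum>x\<in>A. measure_pmf.prob (random_graph n p) {G. S x \<subseteq> G \<and> T x \<inter> G = {}})"
    using \<open>finite A\<close> by (intro measure_pmf.finite_measure_subadditive_finite) auto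
  also have "\<dots> = (\<Sum>x\<in>A. p ^ s * (1 - p) ^ t)"
    using pat p by (intro sum.cong refl) (subst prob_random_graph_pattern, auto)
  finally show ?thesis by simp
qed

section \<open>First moment bounds and elimination orders\<close>

lemma prob_nonempty_graph:
  assumes p: "0 \<le> p" "p \<le> 1"
  shows "measure_pmf.prob (random_graph n p) {G. G \<noteq> {}} \<le> real n ^ 2 * p"
proof -
  have "measure_pmf.prob (random_graph n p) {G. G \<noteq> {}} \<le> real (card (vertex_pairs n)) * (p ^ 1 * (1 - p) ^ 0)"
    by (rule prob_random_graph_union_bound[OF p, where S = "\<lambda>e. {e}" and T = "\<lambda>e. {}"]) auto
  also have "\<dots> \<le> real (n ^ 2) * p"
  proof -
    have "card (vertex_pairs n) \<le> card ((\<lambda>(i, j). {i, j}) ` ({1..n} \<times> {1..n}))"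
      by (rule card_mono[OF _ vertex_pairs_subset]) auto
    also have "\<dots> \<le> card ({1..n} \<times> {1..n})" by (rule card_image_le) auto
    finally have "card (vertex_pairs n) \<le> n ^ 2" by (simp add: power2_eq_square)
    then have "real (card (vertex_pairs n)) \<le> real (n ^ 2)" by (rule of_nat_mono)
    then show ?thesis using p by (simp add: mult_right_mono)
  qed
  finally show ?thesis by simp
qed

lemma prob_adjacent_edges:
  assumes p: "0 \<le> p" "p \<le> 1"
  shows "measure_pmf.prob (random_graph n p) {G. \<exists>i j k. j \<noteq> k \<and> {i, j} \<in> G \<and> {i, k} \<in> G} \<le> real n ^ 3 * p ^ 2"
proof -
  define A where "A = {(i, j, k). i \<in> {1..n} \<and> j \<in> {1..n} \<and> k \<in> {1..n} \<and> i \<noteq> j \<and> i \<noteq> k \<and> j \<noteq> k}"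
  have sub: "A \<subseteq> {1..n} \<times> {1..n} \<times> {1..n}" by (auto simp: A_def)
  then have fin: "finite A" by (rule finite_subset) auto
  have "measure_pmf.prob (random_graph n p) {G. \<exists>i j k. j \<noteq> k \<and> {i, j} \<in> G \<and> {i, k} \<in> G} \<le>
      real (card A) * (p ^ 2 * (1 - p) ^ 0)"
  proof (rule prob_random_graph_union_bound[OF p fin, where S = "\<lambda>(i, j, k). {{i, j}, {i, k}}" and T = "\<lambda>_. {}"])
    fix G assume G: "G \<subseteq> vertex_pairs n" and "\<exists>i j k. j \<noteq> k \<and> {i, j} \<in> G \<and> {i, k} \<in> G"
    then obtain i j k where ijk: "j \<noteq> k" "{i, j} \<in> G" "{i, k} \<in> G" by blast
    then have "{i, j} \<in> vertex_pairs n" "{i, k} \<in> vertex_pairs n" using G by auto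
    then have "(i, j, k) \<in> A" using ijk(1) by (auto simp: A_def vertex_pairs_doubleton)
    then show "\<exists>x\<in>A. (case x of (i, j, k) \<Rightarrow> {{i, j}, {i, k}}) \<subseteq> G \<and> {} \<inter> G = {}"
      using ijk by (intro bexI[of _ "(i, j, k)"]) auto
  qed (auto simp: A_def vertex_pairs_doubleton doubleton_eq_iff)
  also have "\<dots> \<le> real (n ^ 3) * p ^ 2"
  proof -
    have "card A \<le> card ({1..n} \<times> {1..n} \<times> {1..n})" by (rule card_mono[OF _ sub]) auto
    then have "card A \<le> n ^ 3" by (simp add: power3_eq_cube card_cartesian_product)
    then have "real (card A) \<le> real (n ^ 3)" by (rule of_nat_mono)
    then show ?thesis using p by (simp add: mult_right_mono)
  qed
  finally show ?thesis by simp
qed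

text \<open>If \<open>W\<close> contains the edge, removing one endpoint leaves no edge; otherwise
  any vertex works.\<close>

lemma elimination_order_at_most_one_edge:
  assumes "\<And>e e'. e \<in> G \<Longrightarrow> e' \<in> G \<Longrightarrow> e = e'"
  shows "elimination_order n G"
  unfolding elimination_order_def
proof (intro allI impI)
  fix W :: "nat set" assume "W \<noteq> {}"
  show "\<exists>v\<in>W. \<forall>a\<in>W - {v}. \<forall>b\<in>W - {v}. {a, b} \<in> G \<longrightarrow> {v, a} \<in> G \<or> {v, b} \<in> G"
  proof (cases "\<exists>a\<in>W. \<exists>b\<in>W. {a, b} \<in> G")
    case True
    then obtain a b where "a \<in> W" "b \<in> W" "{a, b} \<in> G" by blast
    moreover have "{a', b'} \<noteq> {a, b}" if "a' \<noteq> a" "b' \<noteq> a" for a' b'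
      using that by auto
    ultimately have "\<forall>a'\<in>W - {a}. \<forall>b'\<in>W - {a}. {a', b'} \<notin> G" using assms by blast
    then show ?thesis using \<open>a \<in> W\<close> by blast
  next
    case False
    then show ?thesis using \<open>W \<noteq> {}\<close> by blast
  qed
qed

text \<open>A certificate of failure for the union bound: with k = |W|, the k missing pairs cost (1
  - p)^k, which pays for the roughly n^k choices of \<open>W\<close>.\<close>

lemma no_elimination_order_dense:
  assumes G: "G \<subseteq> vertex_pairs n" and "\<not> elimination_order n G"
  obtains W T where "W \<subseteq> {1..n}" "W \<noteq> {}" "T \<subseteq> vertex_pairs n \<inter> Pow W" "card T = card W" "T \<inter> G = {}"
proof -
  from assms(2) obtain W where W: "W \<subseteq> {1..n}" "W \<noteq> {}"
    and ex: "\<And>v. v \<in> W \<Longrightarrow> \<exists>a\<in>W - {v}. \<exists>b\<in>W - {v}. {a, b} \<in> G \<and> {v, a} \<notin> G \<and> {v, b} \<notin> G"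
    unfolding elimination_order_def by metis
  have fin: "finite W" using W(1) finite_subset by blast
  \<comment> \<open>Each vertex of \<open>W\<close> has degree at least two in the complement, so the complement has
    at least \<open>card W\<close> edges in \<open>W\<close>.\<close>
  define H where "H = {e \<in> vertex_pairs n. e \<subseteq> W \<and> e \<notin> G}"
  have finH: "finite H" by (simp add: H_def)
  have deg: "card {e \<in> H. v \<in> e} \<ge> 2" if v: "v \<in> W" for v
  proof -
    from ex[OF v] obtain a b where ab: "a \<in> W - {v}" "b \<in> W - {v}" "{a, b} \<in> G" "{v, a} \<notin> G" "{v, b} \<notin> G" by blast
    have "{a, b} \<in> vertex_pairs n" using ab(3) G by blast
    then have "a \<noteq> b" by (simp only: vertex_pairs_doubleton) blast
    then have "card {{v, a}, {v, b}} = 2" by (auto simp: doubleton_eq_iff)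
    moreover have "{{v, a}, {v, b}} \<subseteq> {e \<in> H. v \<in> e}"
      using ab v W(1) by (auto simp: H_def vertex_pairs_doubleton subset_iff)
    ultimately show ?thesis using card_mono[of "{e \<in> H. v \<in> e}" "{{v, a}, {v, b}}"] finH by auto
  qed
  have "2 * card W = (\<Sum>v\<in>W. 2)" by simp
  also have "\<dots> \<le> (\<Sum>v\<in>W. card {e \<in> H. v \<in> e})" by (rule sum_mono) (rule deg)
  also have "\<dots> = 2 * card H"
  proof (rule sum_multicount[OF fin finH], rule ballI)
    fix e assume e: "e \<in> H"
    then have "{v \<in> W. v \<in> e} = e" by (auto simp: H_def)
    then show "card {v \<in> W. v \<in> e} = 2" using e by (auto simp: H_def vertex_pairs_def)
  qed
  finally have "card W \<le> card H" by simp
  then obtain T where T: "T \<subseteq> H" "card T = card W" by (rule obtain_subset_with_card_n)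
  show ?thesis
    by (rule that[of W T]) (use W T in \<open>auto simp: H_def\<close>)
qed

text \<open>The number k^k / k! is a single term of the series of exp(k).\<close>

lemma power_self_le_fact_exp: "real k ^ k \<le> fact k * exp (real k)"
proof -
  have "(\<Sum>i\<in>{k}. real k ^ i /\<^sub>R fact i) \<le> suminf (\<lambda>i. real k ^ i /\<^sub>R fact i)"
    by (rule sum_le_suminf[OF summable_exp_generic]) auto
  then show ?thesis by (simp add: exp_def field_simps)
qed

text \<open>Each binomial coefficient is at most m^k / k!. The surplus k^(2k) / (k!)^2 is at most
  exp(2k), whence the constant \<open>exp 2\<close>.\<close>

lemma binomial_product_bound:
  assumes "q \<ge> 0"
  shows "real ((n choose k) * ((k ^ 2) choose k)) * q ^ k \<le> (exp 2 * (real n * q)) ^ k"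
proof -
  have b: "real (m choose k) * fact k \<le> real m ^ k" for m
    using binomial_fact_pow[of m k] by (metis of_nat_fact of_nat_le_iff of_nat_mult of_nat_power)
  have "real ((n choose k) * ((k ^ 2) choose k)) * (fact k * fact k) = (real (n choose k) * fact k) * (real ((k ^ 2) choose k) * fact k)"
    by simp
  also have "\<dots> \<le> real n ^ k * real (k ^ 2) ^ k"
    by (intro mult_mono b) auto
  also have "\<dots> = real n ^ k * (real k ^ k * real k ^ k)"
    by (simp add: power2_eq_square power_mult_distrib)
  also have "\<dots> \<le> real n ^ k * ((fact k * exp (real k)) * (fact k * exp (real k)))"
    by (intro mult_left_mono mult_mono power_self_le_fact_exp) auto
  also have "\<dots> = (real n ^ k * exp 2 ^ k) * (fact k * fact k)"
    by (simp add: exp_of_nat_mult[symmetric] exp_add[symmetric] mult_ac)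
  finally have "real ((n choose k) * ((k ^ 2) choose k)) \<le> real n ^ k * exp 2 ^ k"
    by (subst (asm) mult_le_cancel_right_pos) auto
  then have "real ((n choose k) * ((k ^ 2) choose k)) * q ^ k \<le> (real n ^ k * exp 2 ^ k) * q ^ k"
    using assms by (intro mult_right_mono) auto
  then show ?thesis by (simp add: power_mult_distrib mult_ac)
qed

lemma prob_no_elimination_order_dense:
  assumes p: "0 \<le> p" "p \<le> 1"
  shows "measure_pmf.prob (random_graph n p) {G. \<not> elimination_order n G} \<le> 2 * exp 2 * (real n * (1 - p))"
proof -
  define x where "x = exp 2 * (real n * (1 - p))"
  have x0: "x \<ge> 0" using p by (simp add: x_def)
  define A where "A k = (SIGMA W:{W. W \<subseteq> {1..n} \<and> card W = k}. {T. T \<subseteq> vertex_pairs n \<inter> Pow W \<and> card T = k})" for k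
  define B where "B k = {G. \<exists>WT\<in>A k. snd WT \<inter> G = {}}" for k
  have finA: "finite (A k)" for k
    unfolding A_def by (intro finite_SigmaI) auto
  have cardA: "card (A k) \<le> (n choose k) * ((k ^ 2) choose k)" for k
  proof -
    \<comment> \<open>The crude count \<open>k ^ 2\<close> is that of ordered pairs in
      \<open>W\<close>.\<close>
    have "card {T. T \<subseteq> vertex_pairs n \<inter> Pow W \<and> card T = k} \<le> (k ^ 2) choose k"
      if W: "W \<subseteq> {1..n}" "card W = k" for W
    proof -
      have fin: "finite W" using W(1) finite_subset by blast
      have "vertex_pairs n \<inter> Pow W \<subseteq> (\<lambda>(i, j). {i, j}) ` (W \<times> W)"
        by (auto simp: vertex_pairs_def)
      then have "card (vertex_pairs n \<inter> Pow W) \<le> card ((\<lambda>(i, j). {i, j}) ` (W \<times> W))"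
        using fin by (intro card_mono) auto
      also have "\<dots> \<le> card (W \<times> W)" using fin by (intro card_image_le) auto
      finally have "card (vertex_pairs n \<inter> Pow W) \<le> k ^ 2" using W by (simp add: power2_eq_square card_cartesian_product)
      then show ?thesis by (subst n_subsets) (auto intro: binomial_right_mono)
    qed
    then have "(\<Sum>W\<in>{W. W \<subseteq> {1..n} \<and> card W = k}. card {T. T \<subseteq> vertex_pairs n \<inter> Pow W \<and> card T = k}) \<le>
        (\<Sum>W\<in>{W. W \<subseteq> {1..n} \<and> card W = k}. (k ^ 2) choose k)"
      by (intro sum_mono) blast
    then have "card (A k) \<le> (\<Sum>W\<in>{W. W \<subseteq> {1..n} \<and> card W = k}. (k ^ 2) choose k)"
      unfolding A_def by (subst card_SigmaI) auto
    then show ?thesis by (simp add: n_subsets)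
  qed
  have B: "measure_pmf.prob (random_graph n p) (B k) \<le> x ^ k" for k
  proof -
    have "measure_pmf.prob (random_graph n p) (B k) \<le> real (card (A k)) * (p ^ 0 * (1 - p) ^ k)"
      unfolding B_def
      by (rule prob_random_graph_union_bound[OF p finA, where S = "\<lambda>_. {}" and T = snd]) (auto simp: A_def)
    also have "\<dots> \<le> real ((n choose k) * ((k ^ 2) choose k)) * (1 - p) ^ k"
      using p of_nat_mono[OF cardA[of k], where ?'a = real] by (simp add: mult_right_mono del: of_nat_mult)
    also have "\<dots> \<le> x ^ k" unfolding x_def using p by (intro binomial_product_bound) auto
    finally show ?thesis .
  qed
  have "measure_pmf.prob (random_graph n p) {G. \<not> elimination_order n G} \<le>
      measure_pmf.prob (random_graph n p) {G. \<exists>k\<in>{1..n}. G \<in> B k}"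
  proof (rule prob_random_graph_mono)
    fix G assume "G \<subseteq> vertex_pairs n" "\<not> elimination_order n G"
    then obtain W T where WT: "W \<subseteq> {1..n}" "W \<noteq> {}" "T \<subseteq> vertex_pairs n \<inter> Pow W" "card T = card W" "T \<inter> G = {}"
      by (rule no_elimination_order_dense)
    then have "G \<in> B (card W)" by (auto simp: B_def A_def intro!: bexI[of _ "(W, T)"])
    moreover have "finite W" using WT(1) finite_subset by blast
    then have "card W \<in> {1..n}" using WT(1,2) card_mono[OF _ WT(1)] by (auto simp: Suc_le_eq card_gt_0_iff)
    ultimately show "\<exists>k\<in>{1..n}. G \<in> B k" by blast
  qed
  also have "{G. \<exists>k\<in>{1..n}. G \<in> B k} = (\<Union>k\<in>{1..n}. B k)" by auto
  also have "measure_pmf.prob (random_graph n p) \<dots> \<le> (\<Sum>k\<in>{1..n}. measure_pmf.prob (random_graph n p) (B k))"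
    by (rule measure_pmf.finite_measure_subadditive_finite) auto
  also have "\<dots> \<le> (\<Sum>k\<in>{1..n}. x ^ k)" by (rule sum_mono) (rule B)
  finally have le: "measure_pmf.prob (random_graph n p) {G. \<not> elimination_order n G} \<le> (\<Sum>k\<in>{1..n}. x ^ k)" .
  show ?thesis
  \<comment> \<open>For \<open>x\<close> at most 1/2 the geometric series is at most
    \<open>2 * x\<close>; for larger \<open>x\<close> the claimed bound exceeds 1.\<close>
  proof (cases "2 * x \<le> 1")
    case True
    have "(\<Sum>k\<in>{1..n}. x ^ k) \<le> (\<Sum>k\<in>{1..n}. x * (1/2) ^ (k - 1))"
    proof (rule sum_mono)
      fix k assume "k \<in> {1..n}"
      then have "x ^ k = x * x ^ (k - 1)" by (cases k) auto
      also have "\<dots> \<le> x * (1/2) ^ (k - 1)" using True x0 by (intro mult_left_mono power_mono) auto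
      finally show "x ^ k \<le> x * (1/2) ^ (k - 1)" .
    qed
    also have "\<dots> = x * (\<Sum>k<n. (1/2) ^ k)"
      unfolding sum_distrib_left[symmetric]
      by (intro arg_cong[where f = "(*) x"] sum.reindex_bij_witness[of _ Suc "\<lambda>k. k - 1"]) auto
    also have "\<dots> \<le> x * 2"
      using x0 by (intro mult_left_mono) (auto simp: geometric_sum)
    finally show ?thesis using le by (simp add: x_def)
  next
    case False
    moreover have "2 * exp 2 * (real n * (1 - p)) = 2 * x" by (simp add: x_def)
    ultimately show ?thesis using measure_pmf.prob_le_1[of "random_graph n p" "{G. \<not> elimination_order n G}"]
      by linarith
  qed
qed

text \<open>For p \<le> 1/2 the factor (1 - p)^2 is at least 1/4, so n^2 p \<le> 4z and edgeless
  graphs suffice. For p > 1/2 one has (n(1 - p))^2 \<le> 2z and the bound linear in n(1 - p)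
  applies. The sum of both estimates covers either case.\<close>

lemma prob_no_elimination_order:
  fixes n :: nat and p :: real
  defines "z \<equiv> (real n * (1 - p)) ^ 2 * p"
  assumes p: "0 \<le> p" "p \<le> 1"
  shows "measure_pmf.prob (random_graph n p) {G. \<not> elimination_order n G} \<le> 4 * z + 2 * exp 2 * sqrt (2 * z)"
proof -
  have z0: "z \<ge> 0" using p by (simp add: z_def)
  show ?thesis
  proof (cases "p \<le> 1 / 2")
    case True
    have "measure_pmf.prob (random_graph n p) {G. \<not> elimination_order n G} \<le>
        measure_pmf.prob (random_graph n p) {G. G \<noteq> {}}"
      by (rule prob_random_graph_mono) (auto intro: elimination_order_at_most_one_edge)
    also have "\<dots> \<le> real n ^ 2 * p" by (rule prob_nonempty_graph[OF p])
    also have "\<dots> \<le> 4 * z"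
    proof -
      have "(1/2) ^ 2 \<le> (1 - p) ^ 2" using True by (intro power_mono) auto
      then have "real n ^ 2 * p * (1/2) ^ 2 \<le> real n ^ 2 * p * (1 - p) ^ 2"
        using p by (intro mult_left_mono) auto
      then show ?thesis by (simp add: z_def power_mult_distrib power2_eq_square mult_ac)
    qed
    also have "\<dots> \<le> 4 * z + 2 * exp 2 * sqrt (2 * z)" using z0 by simp
    finally show ?thesis .
  next
    case False
    have "(real n * (1 - p)) ^ 2 * 1 \<le> (real n * (1 - p)) ^ 2 * (2 * p)"
      using False by (intro mult_left_mono) auto
    then have "real n * (1 - p) \<le> sqrt (2 * z)"
      by (intro real_le_rsqrt) (simp add: z_def mult_ac)
    then have "2 * exp 2 * (real n * (1 - p)) \<le> 2 * exp 2 * sqrt (2 * z)"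
      by (intro mult_left_mono) auto
    then show ?thesis using prob_no_elimination_order_dense[OF p, of n] z0 by linarith
  qed
qed

section \<open>The second moment\<close>

text \<open>Chebyshev's inequality for the number of events that occur: if none does, the count
  deviates from its mean by the mean itself.\<close>

lemma second_moment_method:
  fixes M :: "'a pmf" and A :: "'i \<Rightarrow> 'a set"
  assumes fin: "finite I" and \<mu>: "\<mu> = (\<Sum>i\<in>I. measure_pmf.prob M (A i))" "\<mu> > 0"
  shows "measure_pmf.prob M {x. \<forall>i\<in>I. x \<notin> A i} \<le>
    (\<Sum>i\<in>I. \<Sum>j\<in>I. measure_pmf.prob M (A i \<inter> A j)) / \<mu> ^ 2 - 1"
proof -
  define X where "X x = (\<Sum>i\<in>I. indicator (A i) x :: real)" for x
  let ?E = "measure_pmf.expectation M"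
  have X2: "X x ^ 2 = (\<Sum>i\<in>I. \<Sum>j\<in>I. indicator (A i \<inter> A j) x)" for x
    by (simp add: X_def power2_eq_square sum_product indicator_inter_arith)
  have int: "integrable M (X :: 'a \<Rightarrow> real)" "integrable M (\<lambda>x. X x ^ 2)"
    unfolding X2 unfolding X_def
    by (auto intro!: Bochner_Integration.integrable_sum simp: measure_pmf.emeasure_eq_measure)
  have EX: "?E X = \<mu>"
    unfolding X_def \<mu>(1) by (subst Bochner_Integration.integral_sum) (auto simp: measure_pmf.emeasure_eq_measure)
  have EX2: "?E (\<lambda>x. X x ^ 2) = (\<Sum>i\<in>I. \<Sum>j\<in>I. measure_pmf.prob M (A i \<inter> A j))"
    unfolding X2
    by (subst Bochner_Integration.integral_sum,
        (auto intro!: Bochner_Integration.integrable_sum simp: measure_pmf.emeasure_eq_measure)[1])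
       (simp add: Bochner_Integration.integral_sum measure_pmf.emeasure_eq_measure)
  have "measure_pmf.prob M {x. \<forall>i\<in>I. x \<notin> A i} \<le>
      measure_pmf.prob M {x \<in> space (measure_pmf M). \<mu> \<le> \<bar>X x - ?E X\<bar>}"
    using \<mu>(2) by (intro measure_pmf.finite_measure_mono) (auto simp: EX X_def)
  also have "\<dots> \<le> ?E (\<lambda>x. (X x - ?E X) ^ 2) / \<mu> ^ 2"
    by (rule measure_pmf.Chebyshev_inequality) (use int \<mu>(2) in auto)
  also have "?E (\<lambda>x. (X x - ?E X) ^ 2) = ?E (\<lambda>x. X x ^ 2) - \<mu> ^ 2"
    using measure_pmf.variance_eq[OF int] by (simp add: EX)
  finally show ?thesis using \<mu>(2) by (simp add: EX2 diff_divide_distrib)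
qed

text \<open>The four vertices of a candidate are taken from different residue classes modulo 4, so that
  two candidates share vertices only in the same position and are never in conflict.\<close>

definition vertex :: "nat \<Rightarrow> nat \<Rightarrow> nat" where
  "vertex i a = 4 * a + i + 1"

lemma vertex_eq_iff: "i < 4 \<Longrightarrow> j < 4 \<Longrightarrow> vertex i a = vertex j b \<longleftrightarrow> i = j \<and> a = b"
  unfolding vertex_def by presburger

definition present :: "nat \<times> nat \<times> nat \<times> nat \<Rightarrow> nat set set" where
  "present = (\<lambda>(a, b, c, d). {{vertex 0 a, vertex 1 b}, {vertex 2 c, vertex 3 d}})"

definition absent :: "nat \<times> nat \<times> nat \<times> nat \<Rightarrow> nat set set" where
  "absent = (\<lambda>(a, b, c, d). {{vertex 0 a, vertex 2 c}, {vertex 0 a, vertex 3 d},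
     {vertex 1 b, vertex 2 c}, {vertex 1 b, vertex 3 d}})"

text \<open>If the candidates \<open>t\<close> and \<open>t'\<close> share $e$ edges and $f$ non-edges, then the joint probability exceeds the
  product of the probabilities by the factor $p^{-e} (1 - p)^{-f}$, which is one of the summands.\<close>

definition overlap :: "real \<Rightarrow> nat \<times> nat \<times> nat \<times> nat \<Rightarrow> nat \<times> nat \<times> nat \<times> nat \<Rightarrow> real" where
  "overlap p = (\<lambda>(a, b, c, d) (a', b', c', d'). 1
     + of_bool (a' = a) * of_bool (b' = b) / p + of_bool (c' = c) * of_bool (d' = d) / p
     + of_bool (a' = a) * of_bool (c' = c) / (1 - p) + of_bool (a' = a) * of_bool (d' = d) / (1 - p)
     + of_bool (b' = b) * of_bool (c' = c) / (1 - p) + of_bool (b' = b) * of_bool (d' = d) / (1 - p)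
     + of_bool (a' = a) * of_bool (b' = b) * of_bool (c' = c) / (p * (1 - p) ^ 2)
     + of_bool (a' = a) * of_bool (b' = b) * of_bool (d' = d) / (p * (1 - p) ^ 2)
     + of_bool (a' = a) * of_bool (c' = c) * of_bool (d' = d) / (p * (1 - p) ^ 2)
     + of_bool (b' = b) * of_bool (c' = c) * of_bool (d' = d) / (p * (1 - p) ^ 2)
     + of_bool (a' = a) * of_bool (b' = b) * of_bool (c' = c) * of_bool (d' = d) / (p ^ 2 * (1 - p) ^ 4))"

lemma card_present: "card (present t) = 2"
  and card_absent: "card (absent t) = 4"
  and present_absent: "present t \<inter> absent t' = {}"
  by (cases t; cases t'; simp add: present_def absent_def doubleton_eq_iff vertex_eq_iff)+

lemma card_present_Un:
  "card (present (a, b, c, d) \<union> present (a', b', c', d')) = 4 - of_bool (a' = a \<and> b' = b) - of_bool (c' = c \<and> d' = d)"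
  by (cases "a' = a"; cases "b' = b"; cases "c' = c"; cases "d' = d")
     (simp_all add: present_def doubleton_eq_iff vertex_eq_iff card_insert_if)

lemma card_absent_Un:
  "card (absent (a, b, c, d) \<union> absent (a', b', c', d')) = 8 - of_bool (a' = a \<and> c' = c)
     - of_bool (a' = a \<and> d' = d) - of_bool (b' = b \<and> c' = c) - of_bool (b' = b \<and> d' = d)"
  by (cases "a' = a"; cases "b' = b"; cases "c' = c"; cases "d' = d")
     (simp_all add: absent_def doubleton_eq_iff vertex_eq_iff card_insert_if)

text \<open>Sixteen cases according to the positions in which the candidates agree. The exact factor
  is always one of the summands of \<open>overlap\<close>, and the others are nonnegative;
  \<open>scale\<close> clears denominators so that only products of powers are compared.\<close>

lemma overlap_count:
  assumes p: "0 < p" "p < 1"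
  shows "p ^ card (present t \<union> present t') * (1 - p) ^ card (absent t \<union> absent t') \<le>
    (p ^ 2 * (1 - p) ^ 4) ^ 2 * overlap p t t'"
proof -
  obtain a b c d where t: "t = (a, b, c, d)" by (cases t)
  obtain a' b' c' d' where t': "t' = (a', b', c', d')" by (cases t')
  define q where "q = 1 - p"
  have q: "q > 0" "1 - p = q" using p by (auto simp: q_def)
  have scale: "(p ^ 2 * q ^ 4) ^ 2 * 1 = p ^ 4 * q ^ 8"
    "(p ^ 2 * q ^ 4) ^ 2 * (x / p) = x * (p ^ 3 * q ^ 8)"
    "(p ^ 2 * q ^ 4) ^ 2 * (x / q) = x * (p ^ 4 * q ^ 7)"
    "(p ^ 2 * q ^ 4) ^ 2 * (x / (p * q ^ 2)) = x * (p ^ 3 * q ^ 6)"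
    "(p ^ 2 * q ^ 4) ^ 2 * (x / (p ^ 2 * q ^ 4)) = x * (p ^ 2 * q ^ 4)" for x
    using p(1) q(1) by (simp_all add: field_simps power_mult_distrib flip: power_mult power_add power_Suc)
  have pos: "0 \<le> p ^ i * q ^ j" for i j using p q by simp
  have "p ^ card (present t \<union> present t') * q ^ card (absent t \<union> absent t') \<le>
    (p ^ 2 * q ^ 4) ^ 2 * overlap p t t'"
    unfolding t t' overlap_def prod.case q(2) distrib_left scale card_present_Un card_absent_Un
    by (cases "a' = a"; cases "b' = b"; cases "c' = c"; cases "d' = d")
       (simp_all add: pos add_nonneg_nonneg)
  then show ?thesis by (simp only: q(2))
qed

text \<open>Prescribing agreement in s positions leaves m^(4-s) candidates. Of the six pairs of
  positions two carry edges and four non-edges, and each of the four triples contains one edge and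
  two non-edges.\<close>

lemma sum_overlap:
  assumes p: "0 < p" "p < 1" and t: "t \<in> {..<m} \<times> {..<m} \<times> {..<m} \<times> {..<m}"
  shows "(\<Sum>t'\<in>{..<m} \<times> {..<m} \<times> {..<m} \<times> {..<m}. overlap p t t') =
    real m ^ 4 + 2 * real m ^ 2 / p + 4 * real m ^ 2 / (1 - p) + 4 * real m / (p * (1 - p) ^ 2) + 1 / (p ^ 2 * (1 - p) ^ 4)"
proof -
  obtain a b c d where abcd: "t = (a, b, c, d)" "a < m" "b < m" "c < m" "d < m" using t by auto
  have one: "(\<Sum>i<m. of_bool (i = e)) = (1 :: real)" if "e < m" for e
    using that by (simp add: of_bool_def sum.delta)
  show ?thesis
    unfolding abcd(1) overlap_def prod.case sum.cartesian_product'
    by (simp add: sum.distrib sum_divide_distrib[symmetric] sum_distrib_left[symmetric] sum_distrib_right[symmetric]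
        one abcd(2-5) del: sum_of_bool_eq)
       (simp add: power2_eq_square power4_eq_xxxx ring_distribs)
qed

text \<open>In a simple graph this is an induced pair of disjoint edges, equivalently an induced
  4-cycle of the complement.\<close>

definition has_gap :: "nat set set \<Rightarrow> bool" where
  "has_gap G \<longleftrightarrow> (\<exists>a b c d. {a, b} \<in> G \<and> {c, d} \<in> G \<and> c \<noteq> d \<and>
     {a, c} \<notin> G \<and> {b, c} \<notin> G \<and> {a, d} \<notin> G \<and> {b, d} \<notin> G)"

lemma prob_no_gap:
  fixes n :: nat and p :: real
  defines "z \<equiv> (real n * (1 - p)) ^ 2 * p"
  assumes p: "0 \<le> p" "p \<le> 1" and n: "n \<ge> 4" and z: "z > 0"
  shows "measure_pmf.prob (random_graph n p) {G. \<not> has_gap G} \<le> 640 / z + 4096 / z ^ 2"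
proof -
  define q where "q = 1 - p"
  define m where "m = n div 4"
  define I where "I = {..<m} \<times> {..<m} \<times> {..<m} \<times> {..<m}"
  define A where "A t = {G. present t \<subseteq> G \<and> absent t \<inter> G = {}}" for t
  define \<pi> where "\<pi> = p ^ 2 * q ^ 4"
  have "p \<noteq> 0" "p \<noteq> 1" using z by (auto simp: z_def)
  then have p': "0 < p" "p < 1" using p by auto
  then have q: "0 < q" "q < 1" by (auto simp: q_def)
  have \<pi>: "\<pi> > 0" using p' q by (simp add: \<pi>_def)
  \<comment> \<open>From n \<le> 4m + 3 and m \<ge> 1; the loss of 8 is squared to 64 when
    \<open>v\<close> is compared with \<open>z\<close>.\<close>
  have m: "m > 0" "n \<le> 8 * m" using n unfolding m_def by presburger+
  have "finite I" by (simp add: I_def)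
  have vertex_in: "vertex i a \<in> {1..n}" if "i < 4" "a < m" for i a
    using that by (auto simp: vertex_def m_def)
  have sub: "present t \<subseteq> vertex_pairs n" "absent t \<subseteq> vertex_pairs n" if "t \<in> I" for t
    using that vertex_in by (auto simp: I_def present_def absent_def vertex_pairs_doubleton vertex_eq_iff)
  have A: "measure_pmf.prob (random_graph n p) (A t) = \<pi>" if "t \<in> I" for t
    unfolding A_def using p sub[OF that]
    by (subst prob_random_graph_pattern) (auto simp: card_present card_absent present_absent \<pi>_def q_def)
  have AA: "measure_pmf.prob (random_graph n p) (A t \<inter> A t') \<le> \<pi> ^ 2 * overlap p t t'" if "t \<in> I" "t' \<in> I" for t t'
  proof -
    have "A t \<inter> A t' = {G. present t \<union> present t' \<subseteq> G \<and> (absent t \<union> absent t') \<inter> G = {}}"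
      by (auto simp: A_def)
    moreover have "(present t \<union> present t') \<inter> (absent t \<union> absent t') = {}"
      by (simp add: Int_Un_distrib Int_Un_distrib2 present_absent)
    ultimately have "measure_pmf.prob (random_graph n p) (A t \<inter> A t') =
        p ^ card (present t \<union> present t') * (1 - p) ^ card (absent t \<union> absent t')"
      using p sub[OF that(1)] sub[OF that(2)] by (simp only:) (intro prob_random_graph_pattern Un_least)
    then show ?thesis using overlap_count[OF p', of t t'] by (simp add: \<pi>_def q_def)
  qed
  have card_I: "real (card I) = real m ^ 4" by (simp add: I_def card_cartesian_product power4_eq_xxxx)
  have \<mu>: "(\<Sum>t\<in>I. measure_pmf.prob (random_graph n p) (A t)) = real m ^ 4 * \<pi>"
    using A by (simp add: card_I)
  define R where "R = real m ^ 4 + 2 * real m ^ 2 / p + 4 * real m ^ 2 / (1 - p) + 4 * real m / (p * (1 - p) ^ 2) + 1 / (p ^ 2 * (1 - p) ^ 4)"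
  define v where "v = real m ^ 2 * p * q ^ 2"
  have v: "v > 0" using p' q m by (simp add: v_def)
  have "measure_pmf.prob (random_graph n p) {G. \<not> has_gap G} \<le> measure_pmf.prob (random_graph n p) {G. \<forall>t\<in>I. G \<notin> A t}"
  proof (rule prob_random_graph_mono, rule ballI, rule notI)
    fix G t assume gap: "\<not> has_gap G" and "t \<in> I" "G \<in> A t"
    obtain a b c d where t: "t = (a, b, c, d)" by (cases t)
    from \<open>G \<in> A t\<close> have "{vertex 0 a, vertex 1 b} \<in> G" "{vertex 2 c, vertex 3 d} \<in> G"
      "{vertex 0 a, vertex 2 c} \<notin> G" "{vertex 1 b, vertex 2 c} \<notin> G" "{vertex 0 a, vertex 3 d} \<notin> G" "{vertex 1 b, vertex 3 d} \<notin> G"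
      by (auto simp: A_def t present_def absent_def)
    moreover have "vertex 2 c \<noteq> vertex 3 d" by (simp add: vertex_eq_iff)
    ultimately show False using gap unfolding has_gap_def by blast
  qed
  also have "\<dots> \<le> (\<Sum>t\<in>I. \<Sum>t'\<in>I. measure_pmf.prob (random_graph n p) (A t \<inter> A t')) / (real m ^ 4 * \<pi>) ^ 2 - 1"
    by (rule second_moment_method[OF \<open>finite I\<close> \<mu>[symmetric]]) (use m \<pi> in simp)
  also have "\<dots> \<le> (\<Sum>t\<in>I. \<Sum>t'\<in>I. \<pi> ^ 2 * overlap p t t') / (real m ^ 4 * \<pi>) ^ 2 - 1"
    by (intro diff_right_mono divide_right_mono sum_mono AA) auto
  also have "(\<Sum>t\<in>I. \<Sum>t'\<in>I. \<pi> ^ 2 * overlap p t t') = (\<Sum>t\<in>I. \<pi> ^ 2 * R)"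
    unfolding sum_distrib_left[symmetric] I_def R_def
    by (intro arg_cong[where f = "(*) _"] sum.cong refl sum_overlap[OF p'])
  also have "\<dots> = real m ^ 4 * (\<pi> ^ 2 * R)"
    by (simp add: card_I)
  also have "real m ^ 4 * (\<pi> ^ 2 * R) / (real m ^ 4 * \<pi>) ^ 2 = R / real m ^ 4"
    using m \<pi> by (simp add: power2_eq_square)
  \<comment> \<open>The summand \<open>real m ^ 4\<close> of \<open>R\<close>, from pairs sharing
    nothing that matters, cancels the 1; the rest is expressed through \<open>v\<close>, the
    analogue of \<open>z\<close> with \<open>m\<close> in place of \<open>n\<close>.\<close>
  also have "R / real m ^ 4 - 1 = 2 * q ^ 2 / v + 4 * (p * q) / v + 4 * (1 / real m) / v + 1 / v ^ 2"
    using m p' q unfolding R_def v_def q_def[symmetric]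
    by (simp add: add_divide_distrib) (simp add: field_simps eval_nat_numeral)
  also have "\<dots> \<le> 2 * 1 / v + 4 * 1 / v + 4 * 1 / v + 1 / v ^ 2"
  proof -
    have "q ^ 2 \<le> 1" "p * q \<le> 1" "1 / real m \<le> 1"
      using p' q m by (auto intro: power_le_one mult_le_one)
    then show ?thesis using v by (intro add_mono divide_right_mono mult_left_mono) auto
  qed
  \<comment> \<open>With v \<ge> z/64 this gives the constants 640 = 10 * 64 and 4096 =
    64^2.\<close>
  also have "\<dots> = 10 / v + 1 / v ^ 2" by (simp add: add_divide_distrib[symmetric])
  also have "\<dots> \<le> 10 / (z / 64) + 1 / (z / 64) ^ 2"
  proof -
    have "z \<le> 64 * v"
    proof -
      have "real n ^ 2 \<le> (8 * real m) ^ 2" using m(2) by (intro power_mono) linarith+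
      then have "real n ^ 2 * (q ^ 2 * p) \<le> (8 * real m) ^ 2 * (q ^ 2 * p)"
        using p' q by (intro mult_right_mono) auto
      then show ?thesis by (simp add: z_def v_def q_def[symmetric] power_mult_distrib mult_ac)
    qed
    then have "z / 64 \<le> v" by simp
    then show ?thesis using z v
      by (intro add_mono divide_left_mono power_mono) auto
  qed
  also have "\<dots> = 640 / z + 4096 / z ^ 2" by (simp add: power_divide)
  finally show ?thesis .
qed

section \<open>Combining the bounds and passing to the limit\<close>

lemma has_gap_or_adjacent_edges:
  assumes G: "G \<subseteq> vertex_pairs n" and e: "e \<in> G" "e' \<in> G" "e \<noteq> e'"
    and no_adj: "\<And>i j k. j \<noteq> k \<Longrightarrow> {i, j} \<in> G \<Longrightarrow> {i, k} \<notin> G"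
  shows "has_gap G"
proof -
  have "e \<in> vertex_pairs n" "e' \<in> vertex_pairs n" using G e by auto
  then obtain a b c d where ab: "e = {a, b}" "a \<noteq> b" and cd: "e' = {c, d}" "c \<noteq> d"
    unfolding vertex_pairs_def by blast
  have ne: "a \<noteq> c" "a \<noteq> d" "b \<noteq> c" "b \<noteq> d"
    using no_adj[of b d a] no_adj[of b c a] no_adj[of a d b] no_adj[of a c b] e ab cd
    by (auto simp: insert_commute)
  have "{a, c} \<notin> G" "{a, d} \<notin> G" "{b, c} \<notin> G" "{b, d} \<notin> G"
    using no_adj[of b c a] no_adj[of b d a] no_adj[of a c b] no_adj[of a d b] ne e ab
    by (auto simp: insert_commute)
  then show ?thesis unfolding has_gap_def using e ab cd by blast
qed

lemma linear_presentation_imp_no_gap: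
  assumes "G \<subseteq> vertex_pairs n" "has_linear_presentation n (edge_ideal (K :: 'k::field itself) n G)"
  shows "\<not> has_gap G"
  unfolding has_gap_def using linear_presentation_no_gap[OF assms] by blast

lemma no_elimination_order_tendsto_0:
  assumes p: "\<And>n. n \<ge> 1 \<Longrightarrow> 0 \<le> p n \<and> p n \<le> 1"
    and z: "(\<lambda>n. (real n * (1 - p n)) ^ 2 * p n) \<longlonglongrightarrow> 0"
  shows "(\<lambda>n. measure_pmf.prob (random_graph n (p n)) {G. \<not> elimination_order n G}) \<longlonglongrightarrow> 0"
proof (rule tendsto_sandwich[OF always_eventually eventually_sequentiallyI tendsto_const])
  show "(\<lambda>n. 4 * ((real n * (1 - p n)) ^ 2 * p n) + 2 * exp 2 * sqrt (2 * ((real n * (1 - p n)) ^ 2 * p n))) \<longlonglongrightarrow> 0"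
    using tendsto_add[OF tendsto_mult[OF tendsto_const[of 4] z]
        tendsto_mult[OF tendsto_const[of "2 * exp 2"] tendsto_real_sqrt[OF tendsto_mult[OF tendsto_const[of 2] z]]]]
    by simp
qed (use p prob_no_elimination_order in auto)

lemma bound_tendsto_0:
  fixes f :: "nat \<Rightarrow> real"
  assumes "filterlim f at_top sequentially"
  shows "(\<lambda>n. 640 / f n + 4096 / f n ^ 2) \<longlonglongrightarrow> 0"
proof -
  have "((\<lambda>x::real. 640 / x + 4096 / x ^ 2) \<longlongrightarrow> 0) at_top" by real_asymp
  from filterlim_compose[OF this assms] show ?thesis .
qed

text \<open>For p \<ge> 1/2 one has z \<ge> (n(1 - p))^2 / 2. For p < 1/2, put s = n^2 p, so that z
  \<ge> s/4: either s \<ge> n^(1/4), or n^3 p^2 = s^2 / n is below n^(-1/2). So z \<ge>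
  \<open>Z\<close>, where a gap is likely, or adjacent edges are unlikely, where a gap-free graph
  has at most one edge. The cut n^(1/4) only has to tend to infinity more slowly than
  n^(1/2).\<close>

lemma prob_linear_presentation_only:
  fixes K :: "'k::field itself" and n :: nat and p :: real
  defines "Z \<equiv> min ((real n * (1 - p)) ^ 2 / 2) (sqrt (sqrt n) / 4)"
  assumes p: "0 \<le> p" "p \<le> 1" and n: "n \<ge> 4" and Z: "Z > 0"
  shows "measure_pmf.prob (random_graph n p)
      {G. \<not> has_linear_resolution n (edge_ideal K n G) \<and> has_linear_presentation n (edge_ideal K n G)}
    \<le> 640 / Z + 4096 / Z ^ 2 + 1 / sqrt n" (is "measure_pmf.prob _ ?bad \<le> _")
proof -
  define z where "z = (real n * (1 - p)) ^ 2 * p"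
  define r where "r = sqrt (sqrt n)"
  have r: "r > 0" "r ^ 2 = sqrt n" "r ^ 4 = real n"
  proof -
    show r2: "r ^ 2 = sqrt n" by (simp add: r_def)
    have "r ^ 4 = (r ^ 2) ^ 2" by simp
    then show "r ^ 4 = real n" unfolding r2 by simp
  qed (use n in \<open>simp add: r_def\<close>)
  consider "Z \<le> z" | "real n ^ 3 * p ^ 2 \<le> 1 / sqrt n"
  proof (cases "p \<ge> 1 / 2")
    case True
    have "(real n * (1 - p)) ^ 2 * (1 / 2) \<le> z" unfolding z_def using True by (intro mult_left_mono) auto
    then have "Z \<le> z" by (simp add: Z_def)
    then show ?thesis by (rule that(1))
  next
    case False
    define s where "s = real n ^ 2 * p"
    have "(1/2) ^ 2 \<le> (1 - p) ^ 2" using False by (intro power_mono) auto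
    then have "s * (1/2) ^ 2 \<le> s * (1 - p) ^ 2" using p by (intro mult_left_mono) (auto simp: s_def)
    then have sz: "s / 4 \<le> z" by (simp add: z_def s_def power_mult_distrib power2_eq_square mult_ac)
    show ?thesis
    proof (cases "r \<le> s")
      case True
      then have "Z \<le> z" using sz by (simp add: Z_def r_def)
      then show ?thesis by (rule that(1))
    next
      case False
      then have "s ^ 2 \<le> r ^ 2" using p by (intro power_mono) (auto simp: s_def)
      have "real n ^ 3 * p ^ 2 = s ^ 2 / r ^ 4"
        unfolding r(3) using n by (simp add: s_def power_mult_distrib eval_nat_numeral)
      also have "\<dots> \<le> r ^ 2 / r ^ 4" using \<open>s ^ 2 \<le> r ^ 2\<close> r(1) by (intro divide_right_mono) auto
      also have "\<dots> = 1 / r ^ 2" using r(1) by (simp add: eval_nat_numeral)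
      finally show ?thesis using r(2) that(2) by simp
    qed
  qed
  then show ?thesis
  proof cases
    case 1
    have "measure_pmf.prob (random_graph n p) ?bad \<le> measure_pmf.prob (random_graph n p) {G. \<not> has_gap G}"
      by (rule prob_random_graph_mono) (use linear_presentation_imp_no_gap in blast)
    also have "\<dots> \<le> 640 / z + 4096 / z ^ 2"
      unfolding z_def using 1 Z by (intro prob_no_gap p n) (simp add: z_def)
    also have "\<dots> \<le> 640 / Z + 4096 / Z ^ 2"
      using 1 Z by (intro add_mono divide_left_mono power_mono) auto
    also have "\<dots> \<le> 640 / Z + 4096 / Z ^ 2 + 1 / sqrt n" by simp
    finally show ?thesis .
  next
    case 2
    have "measure_pmf.prob (random_graph n p) ?bad \<le>
        measure_pmf.prob (random_graph n p) {G. \<exists>i j k. j \<noteq> k \<and> {i, j} \<in> G \<and> {i, k} \<in> G}"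
    proof (rule prob_random_graph_mono, rule ccontr)
      fix G assume G: "G \<subseteq> vertex_pairs n"
        and bad: "\<not> has_linear_resolution n (edge_ideal K n G) \<and> has_linear_presentation n (edge_ideal K n G)"
        and no_adj: "\<not> (\<exists>i j k. j \<noteq> k \<and> {i, j} \<in> G \<and> {i, k} \<in> G)"
      have "\<not> has_gap G" using linear_presentation_imp_no_gap[OF G] bad by blast
      then have "elimination_order n G"
        using has_gap_or_adjacent_edges[OF G] no_adj by (intro elimination_order_at_most_one_edge) blast
      then show False using elimination_order_has_linear_resolution[OF G] bad by blast
    qed
    also have "\<dots> \<le> real n ^ 3 * p ^ 2" by (rule prob_adjacent_edges[OF p])
    also have "\<dots> \<le> 1 / sqrt n" by (rule 2)
    also have "\<dots> \<le> 640 / Z + 4096 / Z ^ 2 + 1 / sqrt n" using Z by simp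
    finally show ?thesis .
  qed
qed

theorem theorem1p1:
  fixes K :: "'k::field itself" and p :: "nat \<Rightarrow> real"
  assumes "\<And>n. n \<ge> 1 \<Longrightarrow> 0 \<le> p n \<and> p n \<le> 1"
  shows
    "((\<lambda>n. (real n * (1 - p n)) ^ 4 * p n ^ 2) \<longlonglongrightarrow> 0 \<longrightarrow>
        (\<lambda>n. measure_pmf.prob (random_graph n (p n))
               {G. has_linear_resolution n (edge_ideal K n G)}) \<longlonglongrightarrow> 1 \<and>
        (\<lambda>n. measure_pmf.prob (random_graph n (p n))
               {G. has_linear_presentation n (edge_ideal K n G)}) \<longlonglongrightarrow> 1) \<and>
     (filterlim (\<lambda>n. (real n * (1 - p n)) ^ 4 * p n ^ 2) at_top sequentially \<longrightarrow>
        (\<lambda>n. measure_pmf.prob (random_graph n (p n))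
               {G. has_linear_resolution n (edge_ideal K n G)}) \<longlonglongrightarrow> 0 \<and>
        (\<lambda>n. measure_pmf.prob (random_graph n (p n))
               {G. has_linear_presentation n (edge_ideal K n G)}) \<longlonglongrightarrow> 0) \<and>
     ((\<lambda>n. real n * (1 - p n)) \<longlonglongrightarrow> 0 \<or>
      filterlim (\<lambda>n. real n * (1 - p n)) at_top sequentially \<longrightarrow>
        (\<lambda>n. measure_pmf.prob (random_graph n (p n))
               {G. \<not> has_linear_resolution n (edge_ideal K n G) \<and>
                   has_linear_presentation n (edge_ideal K n G)}) \<longlonglongrightarrow> 0)"
proof -
  let ?P = "\<lambda>n. measure_pmf.prob (random_graph n (p n))"
  let ?R = "\<lambda>n. {G. has_linear_resolution n (edge_ideal K n G)}"
  let ?L = "\<lambda>n. {G. has_linear_presentation n (edge_ideal K n G)}"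
  let ?bad = "\<lambda>n. {G. \<not> has_linear_resolution n (edge_ideal K n G) \<and> has_linear_presentation n (edge_ideal K n G)}"
  let ?N = "\<lambda>n. {G. \<not> elimination_order n G}"
  define w where "w n = real n * (1 - p n)" for n
  define z where "z n = (real n * (1 - p n)) ^ 2 * p n" for n
  note p = assms
  have z_sq: "(real n * (1 - p n)) ^ 4 * p n ^ 2 = z n ^ 2" for n
    by (simp add: z_def power_mult_distrib flip: power_mult)
  have z_nonneg: "z n \<ge> 0" if "n \<ge> 1" for n using p[OF that] by (simp add: z_def)
  \<comment> \<open>The hypothesis on \<open>p\<close> starts at \<open>n = 1\<close>, so
    nonnegativity is used only eventually; it is needed to return from \<open>z n ^ 2\<close> to
    \<open>z n\<close> by a square root.\<close>
  have z_abs: "eventually (\<lambda>n. \<bar>z n\<bar> = z n) sequentially"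
    using z_nonneg by (intro eventually_sequentiallyI[of 1]) simp
  have R_le_L: "?P n (?R n) \<le> ?P n (?L n)" for n
    by (rule prob_random_graph_mono) (rule has_linear_resolution_imp_presentation)
  have bad_le: "?P n (?bad n) \<le> ?P n (?N n)" for n
    using elimination_order_has_linear_resolution by (intro prob_random_graph_mono) blast
  have R_ge: "1 - ?P n (?N n) \<le> ?P n (?R n)" for n
  proof -
    have "?P n {G. \<not> has_linear_resolution n (edge_ideal K n G)} \<le> ?P n (?N n)"
      using elimination_order_has_linear_resolution by (intro prob_random_graph_mono) blast
    moreover have "?P n {G. \<not> has_linear_resolution n (edge_ideal K n G)} = 1 - ?P n (?R n)"
      using measure_pmf.prob_compl[of "?R n" "random_graph n (p n)"] by (simp add: Collect_neg_eq Compl_eq_Diff_UNIV)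
    ultimately show ?thesis by simp
  qed
  have part1: "(\<lambda>n. ?P n (?R n)) \<longlonglongrightarrow> 1" "(\<lambda>n. ?P n (?L n)) \<longlonglongrightarrow> 1" if z0: "z \<longlonglongrightarrow> 0"
  proof -
    have N: "(\<lambda>n. ?P n (?N n)) \<longlonglongrightarrow> 0"
      by (rule no_elimination_order_tendsto_0[OF p]) (use z0 in \<open>auto simp: z_def[abs_def]\<close>)
    have lower: "(\<lambda>n. 1 - ?P n (?N n)) \<longlonglongrightarrow> 1"
      using tendsto_diff[OF tendsto_const[of 1] N] by simp
    show "(\<lambda>n. ?P n (?R n)) \<longlonglongrightarrow> 1"
      by (rule tendsto_sandwich[OF _ _ lower tendsto_const]) (auto intro!: always_eventually R_ge)
    show "(\<lambda>n. ?P n (?L n)) \<longlonglongrightarrow> 1"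
      by (rule tendsto_sandwich[OF _ _ lower tendsto_const])
         (auto intro!: always_eventually order_trans[OF R_ge R_le_L])
  qed
  have part2: "(\<lambda>n. ?P n (?R n)) \<longlonglongrightarrow> 0" "(\<lambda>n. ?P n (?L n)) \<longlonglongrightarrow> 0"
    if z_top: "filterlim z at_top sequentially"
  proof -
    have "eventually (\<lambda>n. z n > 0) sequentially" using z_top by (auto simp: filterlim_at_top_dense)
    then have le: "eventually (\<lambda>n. ?P n (?L n) \<le> 640 / z n + 4096 / z n ^ 2) sequentially"
      using eventually_ge_at_top[of 4]
    proof eventually_elim
      case (elim n)
      have "?P n (?L n) \<le> ?P n {G. \<not> has_gap G}"
        by (rule prob_random_graph_mono) (rule linear_presentation_imp_no_gap)
      also have "\<dots> \<le> 640 / z n + 4096 / z n ^ 2"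
        unfolding z_def by (rule prob_no_gap) (use elim p[of n] in \<open>auto simp: z_def\<close>)
      finally show ?case .
    qed
    show L: "(\<lambda>n. ?P n (?L n)) \<longlonglongrightarrow> 0"
      by (rule tendsto_sandwich[OF _ le tendsto_const bound_tendsto_0[OF z_top]]) auto
    show "(\<lambda>n. ?P n (?R n)) \<longlonglongrightarrow> 0"
      by (rule tendsto_sandwich[OF _ _ tendsto_const L]) (auto intro!: always_eventually R_le_L)
  qed
  have part3: "(\<lambda>n. ?P n (?bad n)) \<longlonglongrightarrow> 0" if "w \<longlonglongrightarrow> 0"
  proof -
    \<comment> \<open>As p \<le> 1, z is at most w^2 and also tends to 0; then even the failure of
      an elimination order becomes improbable.\<close>
    have upper: "(\<lambda>n. w n ^ 2) \<longlonglongrightarrow> 0" using tendsto_power[OF that, of 2] by simp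
    have "z n \<le> w n ^ 2" if "n \<ge> 1" for n
      unfolding z_def w_def using p[OF that] by (intro mult_left_le) auto
    then have le: "eventually (\<lambda>n. z n \<le> w n ^ 2) sequentially"
      by (rule eventually_sequentiallyI)
    have "eventually (\<lambda>n. 0 \<le> z n) sequentially"
      by (rule eventually_sequentiallyI) (rule z_nonneg)
    from tendsto_sandwich[OF this le tendsto_const upper] have "z \<longlonglongrightarrow> 0" .
    then have N: "(\<lambda>n. ?P n (?N n)) \<longlonglongrightarrow> 0"
      by (intro no_elimination_order_tendsto_0[OF p]) (auto simp: z_def[abs_def])
    show ?thesis
      by (rule tendsto_sandwich[OF _ _ tendsto_const N]) (auto intro!: always_eventually bad_le)
  qed
  have part4: "(\<lambda>n. ?P n (?bad n)) \<longlonglongrightarrow> 0" if w_top: "filterlim w at_top sequentially"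
  proof -
    \<comment> \<open>Both arguments of the minimum tend to infinity, the first by the hypothesis on
      \<open>w\<close>, so the explicit bound on the bad event tends to 0 whatever \<open>p\<close>
      does otherwise.\<close>
    define Z where "Z n = min (w n ^ 2 / 2) (sqrt (sqrt n) / 4)" for n
    have "filterlim (\<lambda>n. w n ^ 2 / 2) at_top sequentially"
    proof -
      have "filterlim (\<lambda>x::real. x ^ 2 / 2) at_top at_top" by real_asymp
      from filterlim_compose[OF this w_top] show ?thesis .
    qed
    moreover have "filterlim (\<lambda>n. sqrt (sqrt (real n)) / 4) at_top sequentially" by real_asymp
    ultimately have Z_top: "filterlim Z at_top sequentially"
      by (simp add: filterlim_at_top Z_def eventually_conj_iff)
    then have "eventually (\<lambda>n. Z n > 0) sequentially" by (auto simp: filterlim_at_top_dense)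
    then have le: "eventually (\<lambda>n. ?P n (?bad n) \<le> 640 / Z n + 4096 / Z n ^ 2 + 1 / sqrt n) sequentially"
      using eventually_ge_at_top[of 4]
    proof eventually_elim
      case (elim n)
      then show ?case unfolding Z_def w_def
        by (intro prob_linear_presentation_only) (use p[of n] in auto)
    qed
    have "(\<lambda>n. 1 / sqrt (real n)) \<longlonglongrightarrow> 0" by real_asymp
    then have "(\<lambda>n. 640 / Z n + 4096 / Z n ^ 2 + 1 / sqrt n) \<longlonglongrightarrow> 0 + 0"
      by (intro tendsto_add bound_tendsto_0[OF Z_top])
    then have "(\<lambda>n. 640 / Z n + 4096 / Z n ^ 2 + 1 / sqrt n) \<longlonglongrightarrow> 0" by simp
    then show ?thesis
      by (intro tendsto_sandwich[OF _ le tendsto_const]) auto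
  qed
  have "z \<longlonglongrightarrow> 0" if "(\<lambda>n. z n ^ 2) \<longlonglongrightarrow> 0"
    using tendsto_real_sqrt[OF that] by (simp add: tendsto_rabs_zero_iff)
  moreover have "filterlim z at_top sequentially" if "filterlim (\<lambda>n. z n ^ 2) at_top sequentially"
  proof -
    have "filterlim (\<lambda>n. sqrt (z n ^ 2)) at_top sequentially"
      using filterlim_compose[OF sqrt_at_top that] .
    then have "filterlim (\<lambda>n. \<bar>z n\<bar>) at_top sequentially" by simp
    then show ?thesis by (rule filterlim_cong[THEN iffD1, rotated -1]) (use z_abs in auto)
  qed
  ultimately show ?thesis
    unfolding z_sq using part1 part2 part3 part4 by (auto simp: w_def[abs_def])
qed

end
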